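(* Let $q$ be a prime power and let $n,s,t$ be positive integers satisfying $\gcd(2n,s)=\gcd(2n,t)=1$. Let $\gamma,\eta\in\mathbb F_{q^{2n}}^*$ be such that $N(\gamma)$ is a non-square in $\mathbb F_q$ and $N(\eta)\ne 1$. Then $\mathcal D_{k,s}(\gamma)$ and $\mathcal H_{k,t}(\eta,h)$ are not equivalent for all $k$ (with $1\le k\le 2n-1$) and all $h$.
   Context: $N=N_{q^{2n}/q}$ denotes the norm from $\mathbb F_{q^{2n}}$ to $\mathbb F_q$. A $q$-polynomial over $\mathbb F_{q^{2n}}$ is a polynomial $\sum_i c_iX^{q^i}$ with $c_i\in\mathbb F_{q^{2n}}$; $q$-polynomials are considered modulo $X^{q^{2n}}-X$ (so the exponent $i$ in $X^{q^i}$ is read modulo $2n$) and are identified with $\mathbb F_q$-linear maps of $\mathbb F_{q^{2n}}$, i.e. with matrices in $\mathbb F_q^{2n\times 2n}$. Define $$\mathcal D_{k,s}(\gamma)=\Big\{aX+\sum_{i=1}^{k-1}c_iX^{q^{is}}+\gamma bX^{q^{ks}} : c_1,\dots,c_{k-1}\in\mathbb F_{q^{2n}},\ a,b\in\mathbb F_{q^n}\Big\}$$ and, for an integer $h$ taken modulo $2n$ (the generalized twisted Gabidulin codes), $$\mathcal H_{k,t}(\eta,h)=\{a_0X+a_1X^{q^t}+\dots+a_{k-1}X^{q^{t(k-1)}}+\eta a_0^{q^h}X^{q^{tk}}: a_i\in\mathbb F_{q^{2n}}\}.$$ Two sets $\mathcal C_1,\mathcal C_2$ of $q$-polynomials over $\mathbb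 F_{q^{2n}}$ are equivalent if there exist $q$-polynomials $\varphi_1,\varphi_2$ over $\mathbb F_{q^{2n}}$ permuting $\mathbb F_{q^{2n}}$, a $q$-polynomial $\psi$ over $\mathbb F_{q^{2n}}$ and $\rho\in\mathrm{Aut}(\mathbb F_q)$ such that $\mathcal C_2=\{\varphi_1\circ f^\rho\circ\varphi_2+\psi: f\in\mathcal C_1\}$, where $f^\rho=\sum a_i^\rho X^{q^i}$ for $f=\sum a_iX^{q^i}$; here $\rho$, a power map $x\mapsto x^{p^e}$ with $p=\mathrm{char}\,\mathbb F_q$, is applied to elements of $\mathbb F_{q^{2n}}$ by the same power map.
   Formalization: The formal theorem assumes n ≥ 2 instead of n ≥ 1: for n = 1 only k = 1 is possible, and then both codes are always equivalent to {aX : a in F_{q^2}}, so the claim as stated fails there. *)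

theory Defs
  imports
    "HOL-Computational_Algebra.Computational_Algebra"
    "HOL-Number_Theory.Prime_Powers"
begin

text \<open>
  Throughout, the field with \<open>q ^ (2 * n)\<close> elements is a finite field type of that cardinality,
  and \<open>Fq_sub q m\<close> is its subfield of order \<open>q ^ m\<close> (for \<open>m\<close> dividing \<open>2 * n\<close>).
\<close>

definition Fq_sub :: "nat \<Rightarrow> nat \<Rightarrow> 'a::field set" where
  "Fq_sub q m = {x. x ^ (q ^ m) = x}"

definition field_norm :: "nat \<Rightarrow> nat \<Rightarrow> 'a::field \<Rightarrow> 'a" where
  "field_norm q n x = (\<Prod>i<2 * n. x ^ (q ^ i))"

text \<open>
  A class of \<open>q\<close>-polynomials modulo \<open>X ^ (q ^ (2 * n)) - X\<close> is represented by its unique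
  reduced member, in which the \<open>q\<close>-exponents are less than \<open>2 * n\<close>.
  The exponent in \<open>qX q n i\<close>, which stands for \<open>X ^ (q ^ i)\<close>, is accordingly reduced
  modulo \<open>2 * n\<close>; being an integer, it may also be negative.
\<close>

definition qX :: "nat \<Rightarrow> nat \<Rightarrow> int \<Rightarrow> 'a::field poly" where
  "qX q n i = monom 1 (q ^ nat (i mod int (2 * n)))"

definition qpolys :: "nat \<Rightarrow> nat \<Rightarrow> 'a::field poly set" where
  "qpolys q n = {(\<Sum>i<2 * n. smult (c i) (qX q n (int i))) | c. True}"

definition qcomp :: "nat \<Rightarrow> nat \<Rightarrow> 'a::field poly \<Rightarrow> 'a poly \<Rightarrow> 'a poly" where
  "qcomp q n f g = (f \<circ>\<^sub>p g) mod (monom 1 (q ^ (2 * n)) - monom 1 1)"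

definition D_code :: "nat \<Rightarrow> nat \<Rightarrow> nat \<Rightarrow> nat \<Rightarrow> 'a::field \<Rightarrow> 'a poly set" where
  "D_code q n k s \<gamma> =
     {smult a (qX q n 0) + (\<Sum>i=1..k - 1. smult (c i) (qX q n (int (i * s))))
        + smult (\<gamma> * b) (qX q n (int (k * s))) | a b c.
      a \<in> Fq_sub q n \<and> b \<in> Fq_sub q n}"

definition H_code :: "nat \<Rightarrow> nat \<Rightarrow> nat \<Rightarrow> nat \<Rightarrow> 'a::field \<Rightarrow> int \<Rightarrow> 'a poly set" where
  "H_code q n k t \<eta> h =
     {(\<Sum>i<k. smult (a i) (qX q n (int (t * i))))
        + smult (\<eta> * a 0 ^ (q ^ nat (h mod int (2 * n)))) (qX q n (int (t * k))) | a. True}"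

text \<open>
  Degenerate case: for \<open>n = 1\<close>, where only \<open>k = 1\<close> is possible, both codes are equivalent to
  the set of all \<open>a X\<close>, i.e. to the field with \<open>q ^ 2\<close> elements, whenever the norm of \<open>\<gamma>\<close> is a
  non-square and the norm of \<open>\<eta>\<close> is not 1. Inequivalence can hold only for \<open>n \<ge> 2\<close>.
\<close>

text \<open>
  An automorphism of the field with \<open>q\<close> elements is given by an exponent \<open>e\<close>, and acts on
  coefficients as \<open>x \<mapsto> x ^ (p ^ e)\<close> with \<open>p\<close> the characteristic.
  Different \<open>e\<close> may induce the same automorphism of the small field; their actions on coefficients
  then differ by conjugation with a power of \<open>X ^ q\<close>, which \<open>\<phi>1\<close> and \<open>\<phi>2\<close> absorb, so no bound
  on \<open>e\<close> is imposed.
\<close>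

definition code_equivalent :: "nat \<Rightarrow> nat \<Rightarrow> 'a::{field, finite} poly set \<Rightarrow> 'a poly set \<Rightarrow> bool" where
  "code_equivalent q n C1 C2 \<longleftrightarrow>
     (\<exists>\<phi>1\<in>qpolys q n. \<exists>\<phi>2\<in>qpolys q n. \<exists>\<psi>\<in>qpolys q n. \<exists>e::nat.
        bij (poly \<phi>1) \<and> bij (poly \<phi>2) \<and>
        C2 = {qcomp q n \<phi>1 (qcomp q n (map_poly (\<lambda>x. x ^ (CHAR('a) ^ e)) f) \<phi>2) + \<psi> | f. f \<in> C1})"

end

theory Submission
  imports Defs "HOL-Number_Theory.Cong"
begin

text \<open>
  The proof compares idealizers. For a set \<open>C\<close> of linear maps, its left idealizer consists of the
  linear maps \<open>f\<close> with \<open>f \<circ> g \<in> C\<close> for all \<open>g \<in> C\<close>, and its right idealizer is defined with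
  \<open>g \<circ> f\<close> instead. An equivalence conjugates each idealizer of one code onto the corresponding
  idealizer of the other, once the additive term is absorbed (\<open>translation_absorbed\<close>) and the
  automorphism of the ground field is absorbed into \<open>\<gamma>\<close> (\<open>D_code_frobenius\<close>). In particular the
  idealizers have the same size.

  Put \<open>N = 2 * n\<close> and expand each code in the iterates of \<open>X ^ (q ^ s)\<close> or \<open>X ^ (q ^ t)\<close>. Both then
  consist of all maps with coefficients at the indices \<open>0, ..., k\<close> whose outer pair, at the indices
  \<open>0\<close> and \<open>k\<close>, lies in a given group \<open>W\<close>, while the inner coefficients are free. Suppose that, up to
  Frobenius twists, \<open>W\<close> contains no line over the big field and, if \<open>k = 1\<close>, satisfies no linear
  relation. Then composition with the inner monomials, or with the elements of the code itself if
  \<open>k = 1\<close>, shows that an idealizer contains only multiplications by scalars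
  (\<open>left_idealizer_coeffs\<close>, \<open>right_idealizer_coeffs\<close>). It remains to see which scalars act on \<open>W\<close>.

  For the code with parameter \<open>\<gamma>\<close> both idealizers are the field with \<open>q ^ n\<close> elements
  (\<open>idealizers_D\<close>). For the twisted Gabidulin code, if \<open>h\<close> is neither \<open>0\<close> nor \<open>t * k\<close> modulo \<open>N\<close>, the
  left idealizer lies in the fixed field of \<open>x \<mapsto> x ^ (q ^ h)\<close> and the right one in that of
  \<open>x \<mapsto> x ^ (q ^ (t * k - h))\<close>. For both to have \<open>q ^ n\<close> elements, \<open>h\<close> and \<open>t * k - h\<close> must be \<open>n\<close> modulo \<open>N\<close>,
  so \<open>N\<close> divides \<open>t * k\<close> and therefore \<open>k\<close>, which is impossible. In the two exceptional cases the left
  or the right idealizer contains all \<open>q ^ N\<close> scalars, which is impossible as well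
  (\<open>codes_not_equivalent\<close>).
\<close>

section \<open>Frobenius powers and linear maps\<close>

text \<open>
  Multiplication by a nonzero \<open>x\<close> permutes the nonzero elements, so their product is unchanged
  when every factor is multiplied by \<open>x\<close>.
\<close>
lemma power_card_UNIV: "x ^ card (UNIV :: 'a set) = x" for x :: "'a::{field,finite}"
proof (cases "x = 0")
  case True
  then show ?thesis
    using finite_UNIV_card_ge_0[where 'a = 'a, OF finite] by (simp only: zero_power)
next
  case False
  have "bij_betw ((*) x) (UNIV - {0}) (UNIV - {0})"
    by (rule bij_betw_byWitness[of _ "\<lambda>y. y / x"]) (use False in auto)
  then have "(\<Prod>y\<in>UNIV - {0}. y) = (\<Prod>y\<in>UNIV - {0}. x * y)"
    by (rule prod.reindex_bij_betw[symmetric])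
  also have "\<dots> = x ^ card (UNIV - {0::'a}) * (\<Prod>y\<in>UNIV - {0}. y)"
    by (simp add: prod.distrib)
  finally have "x ^ card (UNIV - {0::'a}) = 1"
    by simp
  moreover have "card (UNIV :: 'a set) = Suc (card (UNIV - {0::'a}))"
    by (rule card.remove) auto
  ultimately show ?thesis by (simp only: power_Suc mult_1_right)
qed

text \<open>
  The extension of degree \<open>N\<close> of the field with \<open>q\<close> elements; for the codes, \<open>N = 2 * n\<close>. The
  parameter \<open>L\<close> only pins down the type of the elements.
\<close>
locale finite_extension =
  fixes q N :: nat and L :: "'a::{field,finite} itself"
  assumes primepow_q: "primepow q"
    and card_L: "card (UNIV :: 'a set) = q ^ N"
    and N_pos: "N > 0"
begin

lemma q_gt_1: "q > 1"
  using primepow_gt_Suc_0[OF primepow_q] by simp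

lemma prime_CHAR: "prime CHAR('a)"
  by (rule prime_CHAR_semidom) (simp add: finite_imp_CHAR_pos)

lemma q_eq_CHAR_power: "\<exists>r. q = CHAR('a) ^ r"
proof -
  obtain p r where p: "prime p" "q = p ^ r"
    using primepow_q by (auto simp: primepow_def)
  \<comment> \<open>Comparing the sum of all elements with its shift by 1 shows that the cardinality vanishes in the field.\<close>
  have "bij_betw (\<lambda>x. x + 1) UNIV (UNIV :: 'a set)"
    by (rule bij_betw_byWitness[of _ "\<lambda>x. x - 1"]) auto
  then have "(\<Sum>x\<in>(UNIV :: 'a set). x) = (\<Sum>x\<in>UNIV. x + 1)"
    by (rule sum.reindex_bij_betw[symmetric])
  then have "of_nat (q ^ N) = (0 :: 'a)"
    by (simp add: sum.distrib card_L del: of_nat_power)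
  then have "CHAR('a) dvd p ^ (r * N)"
    using p by (simp add: of_nat_eq_0_iff_char_dvd power_mult del: of_nat_power)
  then have "CHAR('a) dvd p"
    by (rule prime_dvd_power[OF prime_CHAR])
  then have "CHAR('a) = p"
    by (rule primes_dvd_imp_eq[OF prime_CHAR p(1)])
  then show ?thesis
    using p(2) by (intro exI[of _ r]) (simp only:)
qed

definition \<sigma> :: "nat \<Rightarrow> 'a \<Rightarrow> 'a" where
  "\<sigma> m x = x ^ (q ^ m)"

lemma \<sigma>_0 [simp]: "\<sigma> 0 x = x"
  and \<sigma>_N [simp]: "\<sigma> N x = x"
  using power_card_UNIV[of x] by (simp_all add: \<sigma>_def card_L)

lemma \<sigma>_\<sigma> [simp]: "\<sigma> l (\<sigma> m x) = \<sigma> (l + m) x"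
  unfolding \<sigma>_def power_mult[symmetric] power_add[symmetric] by (simp only: add.commute)

lemma \<sigma>_one [simp]: "\<sigma> m 1 = 1"
  and \<sigma>_mult: "\<sigma> m (x * y) = \<sigma> m x * \<sigma> m y"
  by (simp_all add: \<sigma>_def power_mult_distrib)

lemma \<sigma>_eq_0_iff [simp]: "\<sigma> m x = 0 \<longleftrightarrow> x = 0"
  using q_gt_1 by (simp add: \<sigma>_def)

lemma \<sigma>_zero [simp]: "\<sigma> m 0 = 0"
  by simp

lemma \<sigma>_add: "\<sigma> m (x + y) = \<sigma> m x + \<sigma> m y"
proof -
  obtain r where "q = CHAR('a) ^ r"
    using q_eq_CHAR_power by blast
  then show ?thesis
    unfolding \<sigma>_def by (intro freshmans_dream'[OF prime_CHAR, of _ "r * m"]) (simp add: power_mult)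
qed

lemma \<sigma>_sum: "\<sigma> m (\<Sum>i\<in>A. f i) = (\<Sum>i\<in>A. \<sigma> m (f i))"
  by (induction A rule: infinite_finite_induct) (auto simp: \<sigma>_add)

lemma \<sigma>_periodic [simp]: "\<sigma> (m + N * j) x = \<sigma> m x"
proof (induction j)
  case (Suc j)
  have "\<sigma> (m + N * Suc j) x = \<sigma> (m + N * j) (\<sigma> N x)"
    unfolding \<sigma>_\<sigma> by (simp add: algebra_simps)
  then show ?case using Suc by simp
qed simp

lemma \<sigma>_mod [simp]: "\<sigma> (m mod N) x = \<sigma> m x"
  using \<sigma>_periodic[of "m mod N" "m div N" x] unfolding mod_mult_div_eq by (rule sym)

lemma \<sigma>_cong: "m mod N = m' mod N \<Longrightarrow> \<sigma> m x = \<sigma> m' x"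
  using \<sigma>_mod[of m x] \<sigma>_mod[of m' x] by (simp only:)

lemma \<sigma>_surj: "\<exists>y. \<sigma> m y = x"
proof
  have "m + m * (N - 1) = 0 + N * m"
    using N_pos by (cases N) auto
  then show "\<sigma> m (\<sigma> (m * (N - 1)) x) = x"
    by (simp only: \<sigma>_\<sigma> \<sigma>_periodic \<sigma>_0)
qed

text \<open>
  The exponents are the multiples of \<open>t\<close>, without reduction modulo \<open>N\<close>. For \<open>t\<close> coprime to \<open>N\<close>
  the maps \<open>\<sigma> (t * i)\<close> are again all the powers of the Frobenius automorphism, so that each
  of the two codes can be expanded in the generator in which its exponents are consecutive.
\<close>
definition lin :: "nat \<Rightarrow> (nat \<Rightarrow> 'a) \<Rightarrow> 'a \<Rightarrow> 'a" where
  "lin t f x = (\<Sum>i<N. f i * \<sigma> (t * i) x)"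

lemma bij_betw_mult_mod:
  assumes "coprime t N"
  shows "bij_betw (\<lambda>i. t * i mod N) {..<N} {..<N}"
proof -
  have "inj_on (\<lambda>i. t * i mod N) {..<N}"
  proof (rule inj_onI)
    fix i j assume ij: "i \<in> {..<N}" "j \<in> {..<N}" "t * i mod N = t * j mod N"
    then have "[i = j] (mod N)"
      using cong_mult_lcancel_nat[OF assms, of i j] by (simp add: cong_def)
    then show "i = j"
      using ij by (simp add: cong_less_modulus_unique_nat)
  qed
  moreover have "(\<lambda>i. t * i mod N) ` {..<N} \<subseteq> {..<N}"
    using N_pos by auto
  ultimately show ?thesis
    using endo_inj_surj[of "{..<N}"] by (auto simp: bij_betw_def)
qed

text \<open>
  Independence of the automorphisms: after reducing exponents modulo \<open>N\<close>, both sides are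
  polynomial functions of degree less than the size of the field, with distinct exponents for
  distinct \<open>i\<close>.
\<close>
lemma lin_coeff_unique:
  assumes "coprime t N" and eq: "\<And>x. lin t f x = lin t g x" and "i < N"
  shows "f i = g i"
proof -
  define P where "P h = (\<Sum>j<N. monom (h j) (q ^ (t * j mod N)))" for h :: "nat \<Rightarrow> 'a"
  have poly_P: "poly (P h) x = lin t h x" for h x
    unfolding P_def lin_def poly_sum
    by (intro sum.cong refl) (simp add: poly_monom \<sigma>_def[symmetric])
  have coeff_P: "coeff (P h) (q ^ (t * i mod N)) = h i" for h
  proof -
    have "coeff (P h) (q ^ (t * i mod N)) = (\<Sum>j<N. if j = i then h j else 0)"
      unfolding P_def coeff_sum
    proof (intro sum.cong refl)
      fix j assume "j \<in> {..<N}"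
      then have "q ^ (t * j mod N) = q ^ (t * i mod N) \<longleftrightarrow> j = i"
        using inj_on_eq_iff[OF bij_betw_imp_inj_on[OF bij_betw_mult_mod[OF assms(1)]], of j i]
          \<open>i < N\<close> power_inject_exp[OF q_gt_1] by simp
      then show "coeff (monom (h j) (q ^ (t * j mod N))) (q ^ (t * i mod N)) = (if j = i then h j else 0)"
        by simp
    qed
    then show ?thesis using \<open>i < N\<close> by simp
  qed
  have "degree (P h) \<le> q ^ (N - 1)" for h
    unfolding P_def
  proof (intro degree_sum_le)
    fix j
    have "t * j mod N \<le> N - 1"
      using N_pos by (metis Suc_pred' less_Suc_eq_le mod_less_divisor)
    then have "q ^ (t * j mod N) \<le> q ^ (N - 1)"
      using q_gt_1 by (intro power_increasing) auto
    then show "degree (monom (h j) (q ^ (t * j mod N))) \<le> q ^ (N - 1)"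
      using degree_monom_le order_trans by blast
  qed auto
  moreover have "q ^ (N - 1) < card (UNIV :: 'a set)"
    unfolding card_L using q_gt_1 N_pos by (intro power_strict_increasing) auto
  ultimately have "P f = P g"
    using eq by (intro poly_eqI_degree[where A = UNIV]) (auto simp: poly_P intro: le_less_trans)
  then show ?thesis
    using coeff_P by metis
qed

lemma lin_change_generator:
  assumes "coprime t N"
  shows "lin 1 f = lin t (\<lambda>i. f (t * i mod N))"
proof
  fix x
  have "lin 1 f x = (\<Sum>i<N. f (t * i mod N) * \<sigma> (t * i mod N) x)"
    using sum.reindex_bij_betw[OF bij_betw_mult_mod[OF assms], of "\<lambda>i. f i * \<sigma> i x"]
    by (simp add: lin_def)
  then show "lin 1 f x = lin t (\<lambda>i. f (t * i mod N)) x"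
    by (simp add: lin_def)
qed

lemma lin_single:
  assumes "j < N"
  shows "lin t ((\<lambda>_. 0)(j := c)) x = c * \<sigma> (t * j) x"
proof -
  have "lin t ((\<lambda>_. 0)(j := c)) x = (\<Sum>i<N. if i = j then c * \<sigma> (t * j) x else 0)"
    unfolding lin_def by (intro sum.cong) auto
  then show ?thesis using assms by simp
qed

lemma lin_add: "lin t (\<lambda>i. f i + g i) x = lin t f x + lin t g x"
  by (simp add: lin_def sum.distrib algebra_simps)

lemma \<sigma>_independent:
  assumes "u mod N \<noteq> v mod N" and eq: "\<And>x. \<alpha> * \<sigma> u x + \<beta> * \<sigma> v x = 0"
  shows "\<alpha> = 0" "\<beta> = 0"
proof -
  define f where "f = (\<lambda>i. ((\<lambda>_. 0)(u mod N := \<alpha>)) i + ((\<lambda>_. 0)(v mod N := \<beta>)) i)"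
  have "lin 1 f x = 0" for x
    unfolding f_def lin_add using N_pos eq[of x] by (simp add: lin_single del: fun_upd_apply)
  then have "f i = 0" if "i < N" for i
    using lin_coeff_unique[of 1 f "\<lambda>_. 0" i] that by (simp add: lin_def)
  from this[of "u mod N"] this[of "v mod N"] show "\<alpha> = 0" "\<beta> = 0"
    using N_pos assms(1) by (auto simp: f_def)
qed

text \<open>
  Composition with \<open>\<sigma> (t * j)\<close> shifts all indices by \<open>j\<close> cyclically; the index \<open>m - j\<close> is
  written \<open>(m + (N - j)) mod N\<close> to stay within the natural numbers.
\<close>
lemma lin_shift:
  assumes "j \<le> N"
  shows "(\<Sum>i<N. A i * \<sigma> (t * (i + j)) x) = lin t (\<lambda>m. A ((m + (N - j)) mod N)) x"
proof -
  have inv1: "((i + j) mod N + (N - j)) mod N = i" if "i < N" for i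
  proof -
    have "((i + j) mod N + (N - j)) mod N = (i + j + (N - j)) mod N"
      by (rule mod_add_left_eq)
    then show ?thesis using assms that by simp
  qed
  have inv2: "((i + (N - j)) mod N + j) mod N = i" if "i < N" for i
  proof -
    have "((i + (N - j)) mod N + j) mod N = (i + (N - j) + j) mod N"
      by (rule mod_add_left_eq)
    then show ?thesis using assms that by simp
  qed
  have sig: "\<sigma> (t * ((i + j) mod N)) x = \<sigma> (t * (i + j)) x" for i
    by (rule \<sigma>_cong) (rule mod_mult_right_eq)
  show ?thesis
    unfolding lin_def
    by (rule sum.reindex_bij_witness[of _ "\<lambda>m. (m + (N - j)) mod N" "\<lambda>i. (i + j) mod N"])
      (use N_pos sig in \<open>auto simp: inv1 inv2\<close>)
qed


definition linear_maps :: "('a \<Rightarrow> 'a) set" where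
  "linear_maps = range (lin 1)"

text \<open>
  The set of maps does not depend on the generator; this lets one conjugate an element of an
  idealizer of one code into an idealizer of the other.
\<close>
lemma linear_maps_eq:
  assumes "coprime t N"
  shows "linear_maps = range (lin t)"
proof
  show "linear_maps \<subseteq> range (lin t)"
    unfolding linear_maps_def using lin_change_generator[OF assms] by auto
next
  show "range (lin t) \<subseteq> linear_maps"
  proof
    fix g assume "g \<in> range (lin t)"
    then obtain f where g: "g = lin t f" by auto
    define f' where "f' = (\<lambda>m. f (the_inv_into {..<N} (\<lambda>i. t * i mod N) m))"
    have "f' (t * i mod N) = f i" if "i < N" for i
      using the_inv_into_f_f[OF bij_betw_imp_inj_on[OF bij_betw_mult_mod[OF assms]], of i] that
      by (simp add: f'_def)
    then have "lin t (\<lambda>i. f' (t * i mod N)) = g"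
      unfolding g by (auto simp: lin_def fun_eq_iff)
    then have "g = lin 1 f'"
      using lin_change_generator[OF assms, of f'] by simp
    then show "g \<in> linear_maps"
      unfolding linear_maps_def by blast
  qed
qed

lemma linear_maps_monomial: "(\<lambda>x. c * \<sigma> m x) \<in> linear_maps"
proof -
  have "lin 1 ((\<lambda>_. 0)(m mod N := c)) = (\<lambda>x. c * \<sigma> m x)"
    using N_pos by (simp add: fun_eq_iff lin_single del: fun_upd_apply)
  then show ?thesis
    unfolding linear_maps_def by (metis rangeI)
qed

lemma linear_maps_sum:
  assumes "\<And>i. i \<in> A \<Longrightarrow> g i \<in> linear_maps"
  shows "(\<lambda>x. \<Sum>i\<in>A. g i x) \<in> linear_maps"
proof -
  have "\<forall>i\<in>A. \<exists>f. g i = lin 1 f"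
    using assms by (auto simp: linear_maps_def)
  then obtain f where f: "\<And>i. i \<in> A \<Longrightarrow> g i = lin 1 (f i)"
    by metis
  have "(\<Sum>i\<in>A. g i x) = lin 1 (\<lambda>j. \<Sum>i\<in>A. f i j) x" for x
  proof -
    have "(\<Sum>i\<in>A. g i x) = (\<Sum>i\<in>A. \<Sum>j<N. f i j * \<sigma> j x)"
      using f by (intro sum.cong) (auto simp: lin_def)
    also have "\<dots> = (\<Sum>j<N. \<Sum>i\<in>A. f i j * \<sigma> j x)"
      by (rule sum.swap)
    finally show ?thesis
      by (simp add: lin_def sum_distrib_right)
  qed
  then show ?thesis
    unfolding linear_maps_def by auto
qed

lemma linear_maps_comp:
  assumes "g \<in> linear_maps" "h \<in> linear_maps"
  shows "g \<circ> h \<in> linear_maps"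
proof -
  obtain a b where a: "g = lin 1 a" and b: "h = lin 1 b"
    using assms by (auto simp: linear_maps_def)
  have "g \<circ> h = (\<lambda>x. \<Sum>i<N. \<Sum>j<N. (a i * \<sigma> i (b j)) * \<sigma> (i + j) x)"
    by (auto simp: a b lin_def fun_eq_iff \<sigma>_sum \<sigma>_mult sum_distrib_left mult.assoc)
  then show ?thesis
    by (simp only:) (intro linear_maps_sum linear_maps_monomial)
qed

lemma linear_maps_scale: "(\<lambda>x. c * x) \<in> linear_maps"
  using linear_maps_monomial[of c 0] by simp

lemma linear_maps_funpow: "g \<in> linear_maps \<Longrightarrow> g ^^ m \<in> linear_maps"
proof (induction m)
  case 0
  have "g ^^ 0 = (\<lambda>x. 1 * x)" by auto
  then show ?case using linear_maps_scale by (simp only:)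
next
  case (Suc m)
  then show ?case using linear_maps_comp unfolding funpow.simps by blast
qed

lemma linear_maps_zero: "g \<in> linear_maps \<Longrightarrow> g 0 = 0"
  by (auto simp: linear_maps_def lin_def)

text \<open>
  A permutation of a finite set has its inverse among its own powers, and these are compositions
  of linear maps.
\<close>
lemma linear_maps_inverse:
  assumes g: "g \<in> linear_maps" and "bij g"
  shows "inv g \<in> linear_maps"
proof -
  have "\<not> inj (\<lambda>m. g ^^ m)"
    using finite_imageD[of "\<lambda>m. g ^^ m" UNIV] by auto
  then obtain i j where ij: "i < j" "g ^^ i = g ^^ j"
    unfolding inj_def by (metis linorder_neqE_nat)
  have "(g ^^ (j - i)) x = x" for x
  proof -
    have "(g ^^ i) ((g ^^ (j - i)) x) = (g ^^ (i + (j - i))) x"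
      by (simp only: funpow_add o_apply)
    also have "i + (j - i) = j"
      using ij(1) by simp
    finally have "(g ^^ i) ((g ^^ (j - i)) x) = (g ^^ i) x"
      by (simp only: ij(2))
    then show ?thesis
      using bij_is_inj[OF bij_fn[OF \<open>bij g\<close>]] by (simp only: inj_eq)
  qed
  moreover have "j - i = Suc (j - i - 1)"
    using ij(1) by simp
  ultimately have "g ((g ^^ (j - i - 1)) x) = x" for x
    by (metis funpow.simps(2) o_apply)
  then have "inv g = g ^^ (j - i - 1)"
    using inv_f_eq[OF bij_is_inj[OF \<open>bij g\<close>]] by blast
  then show ?thesis
    using linear_maps_funpow[OF g, of "j - i - 1"] by (simp only:)
qed

section \<open>Codes with free inner coefficients and their idealizers\<close>

text \<open>
  Both families have this shape: coefficients \<open>1, ..., k - 1\<close> are free and only the pair formed by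
  coefficients \<open>0\<close> and \<open>k\<close> is constrained, to lie in \<open>W\<close>.
\<close>
definition code :: "nat \<Rightarrow> nat \<Rightarrow> ('a \<times> 'a) set \<Rightarrow> ('a \<Rightarrow> 'a) set" where
  "code t k W = {lin t h | h. (h 0, h k) \<in> W \<and> (\<forall>m. k < m \<and> m < N \<longrightarrow> h m = 0)}"

lemma lin_in_code_iff:
  assumes "coprime t N" "k < N"
  shows "lin t h \<in> code t k W \<longleftrightarrow> (h 0, h k) \<in> W \<and> (\<forall>m. k < m \<and> m < N \<longrightarrow> h m = 0)"
proof
  assume "lin t h \<in> code t k W"
  then obtain g where g: "lin t h = lin t g" "(g 0, g k) \<in> W" "\<forall>m. k < m \<and> m < N \<longrightarrow> g m = 0"
    by (auto simp: code_def)
  have "h i = g i" if "i < N" for i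
    using lin_coeff_unique[OF assms(1) _ that] g(1) by metis
  then show "(h 0, h k) \<in> W \<and> (\<forall>m. k < m \<and> m < N \<longrightarrow> h m = 0)"
    using g assms(2) N_pos by auto
qed (auto simp: code_def)

lemma monomial_in_code:
  assumes "0 < j" "j < k" "k < N" "(0, 0) \<in> W"
  shows "(\<lambda>x. c * \<sigma> (t * j) x) \<in> code t k W"
proof -
  have "(\<lambda>x. c * \<sigma> (t * j) x) = lin t ((\<lambda>_. 0)(j := c))"
    using assms by (simp add: fun_eq_iff lin_single del: fun_upd_apply)
  then show ?thesis
    unfolding code_def using assms by (auto intro!: exI[of _ "(\<lambda>_. 0)(j := c)"])
qed

lemma outer_terms_in_code:
  assumes "0 < k" "k < N" "(a, b) \<in> W"
  shows "(\<lambda>x. a * x + b * \<sigma> (t * k) x) \<in> code t k W"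
proof -
  define h where "h = (\<lambda>i. ((\<lambda>_. 0)(0 := a)) i + ((\<lambda>_. 0)(k := b)) i)"
  have "lin t h = (\<lambda>x. a * x + b * \<sigma> (t * k) x)"
    unfolding h_def lin_add using assms N_pos by (auto simp: lin_single fun_eq_iff simp del: fun_upd_apply)
  moreover have "(h 0, h k) \<in> W" "\<forall>m. k < m \<and> m < N \<longrightarrow> h m = 0"
    using assms by (auto simp: h_def)
  ultimately show ?thesis
    unfolding code_def by (intro CollectI exI[of _ h] conjI) (auto simp only:)
qed

definition left_idealizer :: "('a \<Rightarrow> 'a) set \<Rightarrow> ('a \<Rightarrow> 'a) set" where
  "left_idealizer C = {f \<in> linear_maps. \<forall>g\<in>C. f \<circ> g \<in> C}"

definition right_idealizer :: "('a \<Rightarrow> 'a) set \<Rightarrow> ('a \<Rightarrow> 'a) set" where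
  "right_idealizer C = {f \<in> linear_maps. \<forall>g\<in>C. g \<circ> f \<in> C}"

text \<open>
  The index bookkeeping common to left and right idealizers for \<open>k \<ge> 2\<close>. If composing with the
  free monomial of index \<open>j\<close> puts \<open>f (N - j)\<close> and \<open>f (k - j)\<close> into the outer positions, then
  \<open>outer\<close> disposes of the indices below \<open>k\<close> and above \<open>N - k\<close>. The indices between these are
  covered by \<open>middle\<close>, where \<open>j = 1\<close> pushes them into positions beyond \<open>k\<close>.
\<close>
lemma coeffs_vanish:
  fixes f :: "nat \<Rightarrow> 'a"
  assumes "2 \<le> k" "k < N"
    and outer: "\<And>j. 0 < j \<Longrightarrow> j < k \<Longrightarrow> f (N - j) = 0 \<and> f (k - j) = 0"
    and middle: "\<And>m. k < m \<Longrightarrow> m < N \<Longrightarrow> f (m - 1) = 0"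
    and i: "0 < i" "i < N"
  shows "f i = 0"
proof -
  consider "i < k" | "N - i < k" | "k < i + 1" "i + 1 < N"
    using assms(1,2) i by linarith
  then show ?thesis
  proof cases
    case 1
    then show ?thesis using outer[of "k - i"] i by auto
  next
    case 2
    then show ?thesis using outer[of "N - i"] i by auto
  next
    case 3
    then show ?thesis using middle[of "i + 1"] by simp
  qed
qed

lemma mod_shift:
  fixes j k :: nat
  assumes "0 < j" "j < k" "k < N"
  shows "(0 + (N - j)) mod N = N - j" "(k + (N - j)) mod N = k - j"
proof -
  show "(0 + (N - j)) mod N = N - j"
    using assms by simp
  have "k + (N - j) = (k - j) + N"
    using assms by simp
  then have "(k + (N - j)) mod N = (k - j) mod N"
    by (simp only: mod_add_self2)
  then show "(k + (N - j)) mod N = k - j"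
    using assms by simp
qed

lemma mod_pred: "0 < m \<Longrightarrow> m < N \<Longrightarrow> (m + (N - 1)) mod N = m - 1"
proof -
  assume "0 < m" "m < N"
  then have "m + (N - 1) = (m - 1) + N" by simp
  then have "(m + (N - 1)) mod N = (m - 1) mod N"
    by (simp only: mod_add_self2)
  then show ?thesis using \<open>m < N\<close> by simp
qed

text \<open>
  The left idealizer consists of multiplications by scalars. For \<open>k \<ge> 2\<close> one composes with the free
  monomials \<open>c * \<sigma> (t * j) x\<close>: as \<open>c\<close> varies, the outer coefficients of the result trace a twisted
  line in \<open>W\<close>, and \<open>sep\<close> says that \<open>W\<close> contains only the trivial one. For \<open>k = 1\<close>
  there are no free monomials; there one composes with \<open>a * x + b * \<sigma> t x\<close> for \<open>(a, b)\<close> in \<open>W\<close>. The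
  coefficients of the result from index 2 on must vanish, and \<open>sep_k1\<close> says that \<open>W\<close> satisfies no
  nontrivial relation of the resulting form.
\<close>
lemma left_idealizer_coeffs:
  assumes t: "coprime t N" and k: "0 < k" "k < N" and "3 \<le> N"
    and W: "(0, 0) \<in> W"
    and sep: "\<And>\<alpha> \<beta>. (\<And>d. (\<alpha> * d, \<beta> * \<sigma> (t * k) d) \<in> W) \<Longrightarrow> \<alpha> = 0 \<and> \<beta> = 0"
    and sep_k1: "\<And>\<alpha> \<beta> m. 0 < m \<Longrightarrow> k = 1 \<Longrightarrow>
      (\<And>a b. (a, b) \<in> W \<Longrightarrow> \<alpha> * \<sigma> (t * m) a + \<beta> * \<sigma> (t * (m - 1)) b = 0) \<Longrightarrow> \<alpha> = 0 \<and> \<beta> = 0"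
    and f: "lin t f \<in> left_idealizer (code t k W)"
    and i: "0 < i" "i < N"
  shows "f i = 0"
proof -
  have closed: "lin t f \<circ> g \<in> code t k W" if "g \<in> code t k W" for g
    using f that by (auto simp: left_idealizer_def)
  show ?thesis
  proof (cases "k = 1")
    case True
    have *: "f m = 0 \<and> f (m - 1) = 0" if m: "1 < m" "m < N" for m
    proof (rule sep_k1[OF _ True])
      show "0 < m" using m by simp
      fix a b assume ab: "(a, b) \<in> W"
      have "lin t f \<circ> (\<lambda>x. a * x + b * \<sigma> (t * k) x)
          = lin t (\<lambda>m. f m * \<sigma> (t * m) a + f ((m + (N - 1)) mod N) * \<sigma> (t * ((m + (N - 1)) mod N)) b)"
      proof
        fix x
        have "(lin t f \<circ> (\<lambda>x. a * x + b * \<sigma> (t * k) x)) x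
          = (\<Sum>i<N. f i * \<sigma> (t * i) a * \<sigma> (t * i) x) + (\<Sum>i<N. f i * \<sigma> (t * i) b * \<sigma> (t * (i + 1)) x)"
          by (simp add: lin_def \<sigma>_add \<sigma>_mult algebra_simps True sum.distrib)
        then show "(lin t f \<circ> (\<lambda>x. a * x + b * \<sigma> (t * k) x)) x =
          lin t (\<lambda>m. f m * \<sigma> (t * m) a + f ((m + (N - 1)) mod N) * \<sigma> (t * ((m + (N - 1)) mod N)) b) x"
          using lin_shift[of 1 "\<lambda>i. f i * \<sigma> (t * i) b" t x] N_pos by (simp add: lin_add) (simp add: lin_def)
      qed
      then have "f m * \<sigma> (t * m) a + f ((m + (N - 1)) mod N) * \<sigma> (t * ((m + (N - 1)) mod N)) b = 0"
        using closed[OF outer_terms_in_code[OF k ab]] lin_in_code_iff[OF t k(2)] m True by simp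
      then show "f m * \<sigma> (t * m) a + f (m - 1) * \<sigma> (t * (m - 1)) b = 0"
        using m by (simp only: mod_pred)
    qed
    \<comment> \<open>Index 1 is reached from index 2, which exists because \<open>N \<ge> 3\<close>.\<close>
    show ?thesis
      using *[of i] *[of "i + 1"] i \<open>3 \<le> N\<close> by (cases "i = 1") auto
  next
    case False
    have in_code: "lin t (\<lambda>m. f ((m + (N - j)) mod N) * \<sigma> (t * ((m + (N - j)) mod N)) c) \<in> code t k W"
      if j: "0 < j" "j < k" for j c
    proof -
      have "lin t f \<circ> (\<lambda>x. c * \<sigma> (t * j) x)
         = lin t (\<lambda>m. f ((m + (N - j)) mod N) * \<sigma> (t * ((m + (N - j)) mod N)) c)"
      proof
        fix x
        have "(lin t f \<circ> (\<lambda>x. c * \<sigma> (t * j) x)) x = (\<Sum>i<N. f i * \<sigma> (t * i) c * \<sigma> (t * (i + j)) x)"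
          by (simp add: lin_def \<sigma>_mult algebra_simps)
        then show "(lin t f \<circ> (\<lambda>x. c * \<sigma> (t * j) x)) x
           = lin t (\<lambda>m. f ((m + (N - j)) mod N) * \<sigma> (t * ((m + (N - j)) mod N)) c) x"
          using lin_shift[of j "\<lambda>i. f i * \<sigma> (t * i) c" t x] j k by simp
      qed
      then show ?thesis
        using closed[OF monomial_in_code[OF j k(2) W, of c t]] by (simp only:)
    qed
    show ?thesis
    proof (rule coeffs_vanish[where k = k])
      fix j assume j: "0 < j" "j < k"
      show "f (N - j) = 0 \<and> f (k - j) = 0"
      proof (rule sep)
        fix d
        \<comment> \<open>The choice \<open>c = \<sigma> (t * j) d\<close> undoes the twist of the coefficient at index 0.\<close>
        have "(f (N - j) * \<sigma> (t * (N - j)) (\<sigma> (t * j) d), f (k - j) * \<sigma> (t * (k - j)) (\<sigma> (t * j) d)) \<in> W"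
          using in_code[OF j, of "\<sigma> (t * j) d"] j k unfolding lin_in_code_iff[OF t k(2)] mod_shift[OF j k(2)] by blast
        moreover have "t * (N - j) + t * j = 0 + N * t"
          using j k by (simp flip: distrib_left)
        then have "\<sigma> (t * (N - j)) (\<sigma> (t * j) d) = d"
          by (simp only: \<sigma>_\<sigma> \<sigma>_periodic \<sigma>_0)
        moreover have "\<sigma> (t * (k - j)) (\<sigma> (t * j) d) = \<sigma> (t * k) d"
          using j by (simp flip: distrib_left)
        ultimately show "(f (N - j) * d, f (k - j) * \<sigma> (t * k) d) \<in> W"
          by simp
      qed
    next
      fix m assume m: "k < m" "m < N"
      have "f ((m + (N - 1)) mod N) * \<sigma> (t * ((m + (N - 1)) mod N)) 1 = 0"
        using in_code[of 1 1] m False k unfolding lin_in_code_iff[OF t k(2)] by auto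
      then have "f ((m + (N - 1)) mod N) = 0"
        by simp
      moreover have "(m + (N - 1)) mod N = m - 1"
        using m by (intro mod_pred) auto
      ultimately show "f (m - 1) = 0"
        by (simp only:)
    qed (use False k i in auto)
  qed
qed

text \<open>
  The mirror image of the previous lemma. Now the free scalar \<open>c\<close> stays outside all Frobenius powers,
  so the lines in \<open>sep\<close> and the relations in \<open>sep_k1\<close> carry no twist.
\<close>
lemma right_idealizer_coeffs:
  assumes t: "coprime t N" and k: "0 < k" "k < N" and "3 \<le> N"
    and W: "(0, 0) \<in> W"
    and sep: "\<And>\<alpha> \<beta>. (\<And>d. (\<alpha> * d, \<beta> * d) \<in> W) \<Longrightarrow> \<alpha> = 0 \<and> \<beta> = 0"
    and sep_k1: "\<And>\<alpha> \<beta>. k = 1 \<Longrightarrow> (\<And>a b. (a, b) \<in> W \<Longrightarrow> \<alpha> * a + \<beta> * b = 0) \<Longrightarrow> \<alpha> = 0 \<and> \<beta> = 0"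
    and f: "lin t f \<in> right_idealizer (code t k W)"
    and i: "0 < i" "i < N"
  shows "f i = 0"
proof -
  have closed: "g \<circ> lin t f \<in> code t k W" if "g \<in> code t k W" for g
    using f that by (auto simp: right_idealizer_def)
  have shift: "c * \<sigma> (t * j) (lin t f x) = lin t (\<lambda>m. c * \<sigma> (t * j) (f ((m + (N - j)) mod N))) x"
    if "j < N" for j c x
  proof -
    have "c * \<sigma> (t * j) (lin t f x) = (\<Sum>i<N. c * \<sigma> (t * j) (f i) * \<sigma> (t * (i + j)) x)"
      by (simp add: lin_def \<sigma>_sum \<sigma>_mult sum_distrib_left algebra_simps)
    then show ?thesis
      using lin_shift[of j "\<lambda>i. c * \<sigma> (t * j) (f i)" t x] that by simp
  qed
  show ?thesis
  proof (cases "k = 1")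
    case True
    have *: "f m = 0 \<and> \<sigma> (t * 1) (f (m - 1)) = 0" if m: "1 < m" "m < N" for m
    proof (rule sep_k1[OF True])
      fix a b assume ab: "(a, b) \<in> W"
      have "(\<lambda>x. a * x + b * \<sigma> (t * k) x) \<circ> lin t f
          = lin t (\<lambda>m. a * f m + b * \<sigma> (t * 1) (f ((m + (N - 1)) mod N)))"
        using shift[of 1 b] k True by (auto simp: fun_eq_iff lin_add lin_def sum_distrib_left mult.assoc)
      then have "a * f m + b * \<sigma> (t * 1) (f ((m + (N - 1)) mod N)) = 0"
        using closed[OF outer_terms_in_code[OF k ab]] lin_in_code_iff[OF t k(2)] m True by simp
      then show "f m * a + \<sigma> (t * 1) (f (m - 1)) * b = 0"
        using m by (simp only: mod_pred mult.commute)
    qed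
    show ?thesis
      using *[of i] *[of "i + 1"] i \<open>3 \<le> N\<close> by (cases "i = 1") auto
  next
    case False
    have in_code: "lin t (\<lambda>m. c * \<sigma> (t * j) (f ((m + (N - j)) mod N))) \<in> code t k W"
      if j: "0 < j" "j < k" for j c
    proof -
      have "(\<lambda>x. c * \<sigma> (t * j) x) \<circ> lin t f = lin t (\<lambda>m. c * \<sigma> (t * j) (f ((m + (N - j)) mod N)))"
        using shift[of j c] j k by auto
      then show ?thesis
        using closed[OF monomial_in_code[OF j k(2) W, of c t]] by (simp only:)
    qed
    show ?thesis
    proof (rule coeffs_vanish[where k = k])
      fix j assume j: "0 < j" "j < k"
      have "\<sigma> (t * j) (f (N - j)) = 0 \<and> \<sigma> (t * j) (f (k - j)) = 0"
      proof (rule sep)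
        fix d
        show "(\<sigma> (t * j) (f (N - j)) * d, \<sigma> (t * j) (f (k - j)) * d) \<in> W"
          using in_code[OF j, of d] unfolding lin_in_code_iff[OF t k(2)] mod_shift[OF j k(2)]
          by (simp add: mult.commute)
      qed
      then show "f (N - j) = 0 \<and> f (k - j) = 0"
        by simp
    next
      fix m assume m: "k < m" "m < N"
      have "1 * \<sigma> (t * 1) (f ((m + (N - 1)) mod N)) = 0"
        using in_code[of 1 1] m False k unfolding lin_in_code_iff[OF t k(2)] by auto
      then have "f ((m + (N - 1)) mod N) = 0"
        by simp
      moreover have "(m + (N - 1)) mod N = m - 1"
        using m by (intro mod_pred) auto
      ultimately show "f (m - 1) = 0"
        by (simp only:)
    qed (use False k i in auto)
  qed
qed

lemma lin_scalar:
  assumes "\<And>i. 0 < i \<Longrightarrow> i < N \<Longrightarrow> f i = 0"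
  shows "lin t f = (\<lambda>x. f 0 * x)"
proof
  fix x
  have "lin t f x = (\<Sum>i<N. if i = 0 then f 0 * x else 0)"
    unfolding lin_def by (intro sum.cong) (use assms in auto)
  then show "lin t f x = f 0 * x"
    using N_pos by simp
qed

end

section \<open>Fixed fields and the transport of idealizers\<close>

definition scalings :: "'a::field set \<Rightarrow> ('a \<Rightarrow> 'a) set" where
  "scalings S = (\<lambda>b x. b * x) ` S"

text \<open>
  Evaluation at 1 recovers the factor of a scaling, and conjugation by \<open>\<phi>\<close> loses no information.
\<close>
lemma card_le_if_conjugate_scalings:
  fixes \<phi> :: "'a::{field,finite} \<Rightarrow> 'a"
  assumes "bij \<phi>" "\<phi> 0 = 0"
    and conj: "\<And>a. a \<in> S \<Longrightarrow> (\<lambda>x. \<phi> (a * inv \<phi> x)) \<in> scalings T"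
  shows "card S \<le> card T"
proof (rule card_inj_on_le)
  let ?c = "inv \<phi> 1"
  have "?c \<noteq> 0"
    using assms(1,2) by (metis bij_inv_eq_iff zero_neq_one)
  show "inj_on (\<lambda>a. \<phi> (a * ?c)) S"
  proof (rule inj_onI)
    fix a b assume "\<phi> (a * ?c) = \<phi> (b * ?c)"
    then have "a * ?c = b * ?c"
      by (rule injD[OF bij_is_inj[OF assms(1)]])
    then show "a = b"
      using \<open>?c \<noteq> 0\<close> by simp
  qed
  show "(\<lambda>a. \<phi> (a * ?c)) ` S \<subseteq> T"
  proof clarify
    fix a assume "a \<in> S"
    then obtain b where "b \<in> T" and "(\<lambda>x. \<phi> (a * inv \<phi> x)) = (\<lambda>x. b * x)"
      using conj by (auto simp: scalings_def)
    then show "\<phi> (a * ?c) \<in> T"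
      by (metis mult.right_neutral)
  qed
qed simp


context finite_extension
begin

definition Fix :: "nat \<Rightarrow> 'a set" where
  "Fix m = {x. \<sigma> m x = x}"

lemma Fix_one [simp]: "1 \<in> Fix m"
  and Fix_zero [simp]: "0 \<in> Fix m"
  and Fix_mult: "x \<in> Fix m \<Longrightarrow> y \<in> Fix m \<Longrightarrow> x * y \<in> Fix m"
  by (auto simp: Fix_def \<sigma>_mult)

lemma Fix_\<sigma>: "x \<in> Fix m \<Longrightarrow> \<sigma> l x \<in> Fix m"
  by (auto simp: Fix_def) (metis \<sigma>_\<sigma> add.commute)

lemma card_roots_le:
  assumes "degree p < d"
  shows "card {x::'a. x ^ d + poly p x = 0} \<le> d"
proof -
  have deg: "degree (monom 1 d + p) = d"
    using assms by (simp add: degree_add_eq_left degree_monom_eq)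
  then have "monom 1 d + p \<noteq> 0"
    using assms by auto
  from card_poly_roots_bound[OF this] show ?thesis
    by (simp add: deg poly_monom)
qed

text \<open>
  With \<open>c = - 1\<close> this bounds fixed fields from above; with \<open>c = 1\<close> it bounds the fibres of the trace
  map to the fixed field, and hence that field from below.
\<close>
lemma card_\<sigma>_add_le:
  assumes "0 < m" and "c = 1 \<or> c = - 1"
  shows "card {x. \<sigma> m x + c * x = b} \<le> q ^ m"
proof -
  have "1 < q ^ m"
    using one_less_power[OF q_gt_1 assms(1)] .
  then have "degree [:- b, c:] < q ^ m"
    using degree_pCons_le le_less_trans by (metis degree_pCons_0 One_nat_def)
  from card_roots_le[OF this] show ?thesis
    by (simp add: \<sigma>_def algebra_simps eq_neg_iff_add_eq_0 add_eq_0_iff)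
qed

lemma card_Fix_le: "0 < m \<Longrightarrow> card (Fix m) \<le> q ^ m"
  using card_\<sigma>_add_le[of m "- 1" 0] by (simp add: Fix_def)

text \<open>
  The map \<open>\<sigma> n x + x\<close> sends the field with \<open>q ^ (2 * n)\<close> elements into \<open>Fix n\<close>, and each of its fibres
  has at most \<open>q ^ n\<close> elements.
\<close>
lemma card_Fix_ge:
  assumes "N = 2 * n"
  shows "q ^ n \<le> card (Fix n)"
proof -
  have n: "0 < n" using assms N_pos by simp
  have "\<sigma> n x + x \<in> Fix n" for x
    using assms \<sigma>_N[of x] by (simp add: Fix_def \<sigma>_add mult_2[symmetric] add.commute)
  then have "(UNIV :: 'a set) = (\<Union>b\<in>Fix n. {x. \<sigma> n x + x = b})"
    by auto
  then have "card (UNIV :: 'a set) = card (\<Union>b\<in>Fix n. {x. \<sigma> n x + x = b})"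
    by (rule arg_cong)
  also have "\<dots> \<le> (\<Sum>b\<in>Fix n. card {x. \<sigma> n x + x = b})"
    by (rule card_UN_le) simp
  also have "\<dots> \<le> (\<Sum>b\<in>Fix n. q ^ n)"
    using card_\<sigma>_add_le[OF n, of 1] by (intro sum_mono) simp
  finally have "q ^ n * q ^ n \<le> card (Fix n) * q ^ n"
    by (simp add: card_L assms power_add mult_2)
  then show ?thesis
    using q_gt_1 by simp
qed

lemma Fix_gcd: "Fix m \<subseteq> Fix (gcd m N)"
proof (cases "m = 0")
  case False
  then obtain u v where uv: "m * u = N * v + gcd m N"
    using bezout_nat by blast
  show ?thesis
  proof
    fix x assume x: "x \<in> Fix m"
    have "\<sigma> (m * u) x = x" for u
    proof (induction u)
      case (Suc u)
      have "\<sigma> (m * Suc u) x = \<sigma> (m * u) (\<sigma> m x)"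
        unfolding \<sigma>_\<sigma> by (simp add: add.commute)
      also have "\<dots> = x"
        using x Suc by (simp only: Fix_def mem_Collect_eq)
      finally show ?case .
    qed simp
    from this[of u] have "\<sigma> (gcd m N + N * v) x = x"
      by (simp only: uv add.commute)
    then show "x \<in> Fix (gcd m N)"
      by (simp add: Fix_def)
  qed
qed (simp add: Fix_def)

text \<open>
  The fixed field of \<open>\<sigma> m\<close> has at most \<open>q ^ d\<close> elements for \<open>d = gcd m N\<close>. Here \<open>d\<close> is a proper
  divisor of \<open>2 * n\<close> that is at least \<open>n\<close>, so it equals \<open>n\<close>.
\<close>
lemma dvd_if_large_Fix:
  assumes N: "N = 2 * n" and "\<not> N dvd m" and large: "q ^ n \<le> card (Fix m)"
  shows "n dvd m"
proof -
  let ?d = "gcd m N"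
  have pos: "0 < ?d" using N_pos by simp
  have "q ^ n \<le> card (Fix ?d)"
    using large card_mono[OF finite Fix_gcd] by (rule order_trans)
  also have "\<dots> \<le> q ^ ?d"
    by (rule card_Fix_le[OF pos])
  finally have "n \<le> ?d"
    using q_gt_1 power_le_imp_le_exp by blast
  obtain e where e: "N = ?d * e"
    using gcd_dvd2 by blast
  have "e \<noteq> 0" using e N_pos by (intro notI) simp
  moreover have "e \<noteq> 1"
    using e assms(2) gcd_dvd1[of m N] by (intro notI) simp
  ultimately have "2 \<le> e" by simp
  then have "?d * 2 \<le> ?d * e" by (rule mult_le_mono2)
  then have "?d = n"
    using e N \<open>n \<le> ?d\<close> by linarith
  then show ?thesis
    using gcd_dvd1 by metis
qed

text \<open>
  Conjugation by \<open>\<phi>1\<close> carries the left idealizer of \<open>C1\<close> into that of \<open>C2\<close>.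
  The scalings by elements of \<open>S\<close> thus become scalings by elements of \<open>T\<close>.
\<close>
lemma card_le_by_left_idealizers:
  assumes \<phi>1: "\<phi>1 \<in> linear_maps" "bij \<phi>1"
    and C2: "C2 = (\<lambda>g. \<phi>1 \<circ> g \<circ> \<phi>2) ` C1"
    and S: "scalings S \<subseteq> left_idealizer C1" and T: "left_idealizer C2 \<subseteq> scalings T"
  shows "card S \<le> card T"
proof (rule card_le_if_conjugate_scalings[OF \<phi>1(2) linear_maps_zero[OF \<phi>1(1)]])
  fix a assume "a \<in> S"
  then have a: "\<forall>g\<in>C1. (\<lambda>x. a * x) \<circ> g \<in> C1"
    using S by (auto simp: scalings_def left_idealizer_def)
  have "\<phi>1 \<circ> ((\<lambda>x. a * x) \<circ> inv \<phi>1) \<in> linear_maps"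
    using \<phi>1 by (intro linear_maps_comp linear_maps_inverse linear_maps_scale)
  moreover have "\<phi>1 \<circ> ((\<lambda>x. a * x) \<circ> inv \<phi>1) \<circ> g \<in> C2" if g: "g \<in> C2" for g
  proof -
    obtain f where f: "f \<in> C1" "g = \<phi>1 \<circ> f \<circ> \<phi>2"
      using g C2 by blast
    have "\<phi>1 \<circ> ((\<lambda>x. a * x) \<circ> inv \<phi>1) \<circ> g = \<phi>1 \<circ> ((\<lambda>x. a * x) \<circ> f) \<circ> \<phi>2"
      using bij_is_inj[OF \<phi>1(2)] by (auto simp: f(2))
    then show ?thesis
      using a f(1) C2 by (simp only:) blast
  qed
  ultimately have "\<phi>1 \<circ> ((\<lambda>x. a * x) \<circ> inv \<phi>1) \<in> scalings T"
    using T by (auto simp: left_idealizer_def)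
  then show "(\<lambda>x. \<phi>1 (a * inv \<phi>1 x)) \<in> scalings T"
    by (simp add: comp_def)
qed

lemma card_le_by_right_idealizers:
  assumes \<phi>2: "\<phi>2 \<in> linear_maps" "bij \<phi>2"
    and C2: "C2 = (\<lambda>g. \<phi>1 \<circ> g \<circ> \<phi>2) ` C1"
    and S: "scalings S \<subseteq> right_idealizer C1" and T: "right_idealizer C2 \<subseteq> scalings T"
  shows "card S \<le> card T"
proof (rule card_le_if_conjugate_scalings)
  let ?\<psi> = "inv \<phi>2"
  have inv_inv: "inv ?\<psi> = \<phi>2"
    using \<phi>2(2) by (rule inv_inv_eq)
  show "bij ?\<psi>" "?\<psi> 0 = 0"
    using bij_imp_bij_inv[OF \<phi>2(2)] linear_maps_zero[OF linear_maps_inverse[OF \<phi>2]] by auto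
  fix a assume "a \<in> S"
  then have a: "\<forall>g\<in>C1. g \<circ> (\<lambda>x. a * x) \<in> C1"
    using S by (auto simp: scalings_def right_idealizer_def)
  have "?\<psi> \<circ> ((\<lambda>x. a * x) \<circ> \<phi>2) \<in> linear_maps"
    using \<phi>2 by (intro linear_maps_comp linear_maps_inverse linear_maps_scale)
  moreover have "g \<circ> (?\<psi> \<circ> ((\<lambda>x. a * x) \<circ> \<phi>2)) \<in> C2" if g: "g \<in> C2" for g
  proof -
    obtain f where f: "f \<in> C1" "g = \<phi>1 \<circ> f \<circ> \<phi>2"
      using g C2 by blast
    have "g \<circ> (?\<psi> \<circ> ((\<lambda>x. a * x) \<circ> \<phi>2)) = \<phi>1 \<circ> (f \<circ> (\<lambda>x. a * x)) \<circ> \<phi>2"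
      using surj_f_inv_f[OF bij_is_surj[OF \<phi>2(2)]] by (auto simp: f(2))
    then show ?thesis
      using a f(1) C2 by (simp only:) blast
  qed
  ultimately have "?\<psi> \<circ> ((\<lambda>x. a * x) \<circ> \<phi>2) \<in> scalings T"
    using T by (auto simp: right_idealizer_def)
  then show "(\<lambda>x. ?\<psi> (a * inv ?\<psi> x)) \<in> scalings T"
    by (simp add: comp_def inv_inv)
qed

lemma equivalence_inverse:
  assumes "bij \<phi>1" "bij \<phi>2" "C2 = (\<lambda>g. \<phi>1 \<circ> g \<circ> \<phi>2) ` C1"
  shows "C1 = (\<lambda>g. inv \<phi>1 \<circ> g \<circ> inv \<phi>2) ` C2"
proof -
  have "inv \<phi>1 \<circ> (\<phi>1 \<circ> g \<circ> \<phi>2) \<circ> inv \<phi>2 = g" for g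
    using bij_is_inj[OF assms(1)] surj_f_inv_f[OF bij_is_surj[OF assms(2)]] by auto
  then show ?thesis
    by (simp add: assms(3) image_image)
qed

section \<open>Idealizers of the two families\<close>

definition outer_D :: "nat \<Rightarrow> 'a \<Rightarrow> ('a \<times> 'a) set" where
  "outer_D n \<gamma> = {(a, \<gamma> * b) | a b. a \<in> Fix n \<and> b \<in> Fix n}"

definition outer_H :: "'a \<Rightarrow> nat \<Rightarrow> ('a \<times> 'a) set" where
  "outer_H \<eta> h = {(a, \<eta> * \<sigma> h a) | a. True}"

text \<open>
  A scalar in an idealizer of the code acts on \<open>W\<close>; on the right the action on the second
  component is twisted.
\<close>
lemma idealizer_outer:
  assumes t: "coprime t N" and k: "0 < k" "k < N" and ab: "(a, b) \<in> W"
  shows "(\<lambda>x. c * x) \<in> left_idealizer (code t k W) \<Longrightarrow> (c * a, c * b) \<in> W"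
    and "(\<lambda>x. c * x) \<in> right_idealizer (code t k W) \<Longrightarrow> (a * c, b * \<sigma> (t * k) c) \<in> W"
proof -
  define h where "h a b = (\<lambda>i. ((\<lambda>_. 0)(0 := a)) i + ((\<lambda>_. 0)(k := b)) i)" for a b :: 'a
  have h: "lin t (h a b) = (\<lambda>x. a * x + b * \<sigma> (t * k) x)" "h a b 0 = a" "h a b k = b" for a b
  proof -
    show "lin t (h a b) = (\<lambda>x. a * x + b * \<sigma> (t * k) x)"
      unfolding h_def lin_add fun_eq_iff using k N_pos by (simp add: lin_single del: fun_upd_apply)
    show "h a b 0 = a" "h a b k = b"
      using k by (simp_all add: h_def)
  qed
  have outer: "(\<lambda>x. a * x + b * \<sigma> (t * k) x) \<in> code t k W \<Longrightarrow> (a, b) \<in> W" for a b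
    using lin_in_code_iff[OF t k(2), of "h a b" W] h by simp
  {
    assume "(\<lambda>x. c * x) \<in> left_idealizer (code t k W)"
    then have "(\<lambda>x. c * x) \<circ> (\<lambda>x. a * x + b * \<sigma> (t * k) x) \<in> code t k W"
      using outer_terms_in_code[OF k ab] by (auto simp: left_idealizer_def)
    then show "(c * a, c * b) \<in> W"
      by (intro outer) (simp add: comp_def algebra_simps)
  }
  {
    assume "(\<lambda>x. c * x) \<in> right_idealizer (code t k W)"
    then have "(\<lambda>x. a * x + b * \<sigma> (t * k) x) \<circ> (\<lambda>x. c * x) \<in> code t k W"
      using outer_terms_in_code[OF k ab] by (auto simp: right_idealizer_def)
    then show "(a * c, b * \<sigma> (t * k) c) \<in> W"
      by (intro outer) (simp add: comp_def \<sigma>_mult algebra_simps)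
  }
qed

lemma scaling_in_left_idealizer:
  assumes "\<And>a b. (a, b) \<in> W \<Longrightarrow> (c * a, c * b) \<in> W"
  shows "(\<lambda>x. c * x) \<in> left_idealizer (code t k W)"
  unfolding left_idealizer_def
proof (intro CollectI conjI ballI linear_maps_scale)
  fix g assume "g \<in> code t k W"
  then obtain h where h: "g = lin t h" "(h 0, h k) \<in> W" "\<forall>m. k < m \<and> m < N \<longrightarrow> h m = 0"
    by (auto simp: code_def)
  have "(\<lambda>x. c * x) \<circ> g = lin t (\<lambda>i. c * h i)"
    by (auto simp: h(1) lin_def sum_distrib_left mult.assoc)
  then show "(\<lambda>x. c * x) \<circ> g \<in> code t k W"
    unfolding code_def using h assms by (intro CollectI exI[of _ "\<lambda>i. c * h i"]) auto
qed

lemma scaling_in_right_idealizer: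
  assumes "\<And>a b. (a, b) \<in> W \<Longrightarrow> (a * c, b * \<sigma> (t * k) c) \<in> W"
  shows "(\<lambda>x. c * x) \<in> right_idealizer (code t k W)"
  unfolding right_idealizer_def
proof (intro CollectI conjI ballI linear_maps_scale)
  fix g assume "g \<in> code t k W"
  then obtain h where h: "g = lin t h" "(h 0, h k) \<in> W" "\<forall>m. k < m \<and> m < N \<longrightarrow> h m = 0"
    by (auto simp: code_def)
  have "g \<circ> (\<lambda>x. c * x) = lin t (\<lambda>i. h i * \<sigma> (t * i) c)"
    by (auto simp: h(1) lin_def \<sigma>_mult mult.assoc)
  then show "g \<circ> (\<lambda>x. c * x) \<in> code t k W"
    unfolding code_def using h assms by (intro CollectI exI[of _ "\<lambda>i. h i * \<sigma> (t * i) c"]) auto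
qed


text \<open>
  Combination of the two preceding steps: an idealizer consists of scalars, and those act on \<open>W\<close>.
\<close>
lemma left_idealizer_subset:
  assumes t: "coprime t N" and k: "0 < k" "k < N" and "3 \<le> N"
    and W: "(0, 0) \<in> W"
    and sep: "\<And>\<alpha> \<beta>. (\<And>d. (\<alpha> * d, \<beta> * \<sigma> (t * k) d) \<in> W) \<Longrightarrow> \<alpha> = 0 \<and> \<beta> = 0"
    and sep_k1: "\<And>\<alpha> \<beta> m. 0 < m \<Longrightarrow> k = 1 \<Longrightarrow>
      (\<And>a b. (a, b) \<in> W \<Longrightarrow> \<alpha> * \<sigma> (t * m) a + \<beta> * \<sigma> (t * (m - 1)) b = 0) \<Longrightarrow> \<alpha> = 0 \<and> \<beta> = 0"
    and S: "\<And>c. (\<And>a b. (a, b) \<in> W \<Longrightarrow> (c * a, c * b) \<in> W) \<Longrightarrow> c \<in> S"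
  shows "left_idealizer (code t k W) \<subseteq> scalings S"
proof
  fix g assume g: "g \<in> left_idealizer (code t k W)"
  then have "g \<in> range (lin t)"
    using linear_maps_eq[OF t] by (auto simp: left_idealizer_def)
  then obtain f where f: "g = lin t f" by auto
  have "f i = 0" if "0 < i" "i < N" for i
  proof (rule left_idealizer_coeffs[OF t k \<open>3 \<le> N\<close> W _ _ g[unfolded f] that])
    show "\<alpha> = 0 \<and> \<beta> = 0" if "\<And>d. (\<alpha> * d, \<beta> * \<sigma> (t * k) d) \<in> W" for \<alpha> \<beta>
      using that by (rule sep)
    show "\<alpha> = 0 \<and> \<beta> = 0"
      if "0 < m" "k = 1" "\<And>a b. (a, b) \<in> W \<Longrightarrow> \<alpha> * \<sigma> (t * m) a + \<beta> * \<sigma> (t * (m - 1)) b = 0"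
      for \<alpha> \<beta> m
      using that by (rule sep_k1)
  qed
  then have "lin t f = (\<lambda>x. f 0 * x)"
    by (rule lin_scalar)
  with g f idealizer_outer(1)[OF t k, of _ _ W "f 0"] show "g \<in> scalings S"
    unfolding scalings_def by (intro image_eqI[of _ _ "f 0"] S) auto
qed

lemma right_idealizer_subset:
  assumes t: "coprime t N" and k: "0 < k" "k < N" and "3 \<le> N"
    and W: "(0, 0) \<in> W"
    and sep: "\<And>\<alpha> \<beta>. (\<And>d. (\<alpha> * d, \<beta> * d) \<in> W) \<Longrightarrow> \<alpha> = 0 \<and> \<beta> = 0"
    and sep_k1: "\<And>\<alpha> \<beta>. k = 1 \<Longrightarrow> (\<And>a b. (a, b) \<in> W \<Longrightarrow> \<alpha> * a + \<beta> * b = 0) \<Longrightarrow> \<alpha> = 0 \<and> \<beta> = 0"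
    and S: "\<And>c. (\<And>a b. (a, b) \<in> W \<Longrightarrow> (a * c, b * \<sigma> (t * k) c) \<in> W) \<Longrightarrow> c \<in> S"
  shows "right_idealizer (code t k W) \<subseteq> scalings S"
proof
  fix g assume g: "g \<in> right_idealizer (code t k W)"
  then have "g \<in> range (lin t)"
    using linear_maps_eq[OF t] by (auto simp: right_idealizer_def)
  then obtain f where f: "g = lin t f" by auto
  have "f i = 0" if "0 < i" "i < N" for i
  proof (rule right_idealizer_coeffs[OF t k \<open>3 \<le> N\<close> W _ _ g[unfolded f] that])
    show "\<alpha> = 0 \<and> \<beta> = 0" if "\<And>d. (\<alpha> * d, \<beta> * d) \<in> W" for \<alpha> \<beta>
      using that by (rule sep)
    show "\<alpha> = 0 \<and> \<beta> = 0"
      if "k = 1" "\<And>a b. (a, b) \<in> W \<Longrightarrow> \<alpha> * a + \<beta> * b = 0" for \<alpha> \<beta>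
      using that by (rule sep_k1)
  qed
  then have "lin t f = (\<lambda>x. f 0 * x)"
    by (rule lin_scalar)
  with g f idealizer_outer(2)[OF t k, of _ _ W "f 0"] show "g \<in> scalings S"
    unfolding scalings_def by (intro image_eqI[of _ _ "f 0"] S) auto
qed

text \<open>
  A proper subfield contains no line of the big field.
\<close>
lemma Fix_no_line:
  assumes "0 < n" "n < N" "\<And>d. c * d \<in> Fix n"
  shows "c = 0"
proof (rule ccontr)
  assume "c \<noteq> 0"
  then have "x \<in> Fix n" for x
    using assms(3)[of "x / c"] by simp
  then have "card (UNIV :: 'a set) \<le> q ^ n"
    using card_Fix_le[OF assms(1)] by (metis UNIV_eq_I)
  then show False
    unfolding card_L using power_le_imp_le_exp[OF q_gt_1] assms(2) leD by blast
qed

lemma outer_D_sep: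
  assumes n: "0 < n" "n < N" and "\<gamma> \<noteq> 0"
    and W: "\<And>d. (\<alpha> * d, \<beta> * \<sigma> m d) \<in> outer_D n \<gamma>"
  shows "\<alpha> = 0 \<and> \<beta> = 0"
proof
  show "\<alpha> = 0"
    using W by (intro Fix_no_line[OF n]) (auto simp: outer_D_def)
  have "\<beta> / \<gamma> * d \<in> Fix n" for d
  proof -
    obtain c where "\<sigma> m c = d"
      using \<sigma>_surj by blast
    with W[of c] show ?thesis
      using \<open>\<gamma> \<noteq> 0\<close> by (auto simp: outer_D_def)
  qed
  then have "\<beta> / \<gamma> = 0"
    by (rule Fix_no_line[OF n])
  then show "\<beta> = 0"
    using \<open>\<gamma> \<noteq> 0\<close> by simp
qed

lemma zero_in_outer_D: "(0, 0) \<in> outer_D n \<gamma>"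
  and basis_in_outer_D: "(1, 0) \<in> outer_D n \<gamma>" "(0, \<gamma>) \<in> outer_D n \<gamma>"
proof -
  have *: "(a, \<gamma> * b) \<in> outer_D n \<gamma>" if "a \<in> Fix n" "b \<in> Fix n" for a b
    using that by (auto simp: outer_D_def)
  show "(0, 0) \<in> outer_D n \<gamma>" "(1, 0) \<in> outer_D n \<gamma>" "(0, \<gamma>) \<in> outer_D n \<gamma>"
    using *[of 0 0] *[of 1 0] *[of 0 1] by simp_all
qed

text \<open>
  Both idealizers are the field with \<open>q ^ n\<close> elements. Since \<open>(1, 0)\<close> lies in \<open>outer_D n \<gamma>\<close>, a
  scalar of either idealizer must itself be a possible first component.
\<close>
lemma idealizers_D:
  assumes t: "coprime t N" and k: "0 < k" "k < N" and "3 \<le> N"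
    and n: "0 < n" "n < N" and "\<gamma> \<noteq> 0"
  shows "left_idealizer (code t k (outer_D n \<gamma>)) = scalings (Fix n)"
    and "right_idealizer (code t k (outer_D n \<gamma>)) = scalings (Fix n)"
proof -
  show "left_idealizer (code t k (outer_D n \<gamma>)) = scalings (Fix n)"
  proof
    show "left_idealizer (code t k (outer_D n \<gamma>)) \<subseteq> scalings (Fix n)"
    proof (rule left_idealizer_subset[OF t k \<open>3 \<le> N\<close> zero_in_outer_D outer_D_sep[OF n \<open>\<gamma> \<noteq> 0\<close>]])
      fix \<alpha> \<beta> m
      assume *: "\<And>a b. (a, b) \<in> outer_D n \<gamma> \<Longrightarrow> \<alpha> * \<sigma> (t * m) a + \<beta> * \<sigma> (t * (m - 1)) b = 0"
      show "\<alpha> = 0 \<and> \<beta> = 0"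
        using *[OF basis_in_outer_D(1)] *[OF basis_in_outer_D(2)] \<open>\<gamma> \<noteq> 0\<close> by simp
    next
      fix c assume *: "\<And>a b. (a, b) \<in> outer_D n \<gamma> \<Longrightarrow> (c * a, c * b) \<in> outer_D n \<gamma>"
      show "c \<in> Fix n"
        using *[OF basis_in_outer_D(1)] by (auto simp: outer_D_def)
    qed
    show "scalings (Fix n) \<subseteq> left_idealizer (code t k (outer_D n \<gamma>))"
      unfolding scalings_def
    proof clarify
      fix c assume "c \<in> Fix n"
      then show "(\<lambda>x. c * x) \<in> left_idealizer (code t k (outer_D n \<gamma>))"
        by (intro scaling_in_left_idealizer) (auto simp: outer_D_def Fix_mult mult.left_commute)
    qed
  qed
  show "right_idealizer (code t k (outer_D n \<gamma>)) = scalings (Fix n)"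
  proof
    show "right_idealizer (code t k (outer_D n \<gamma>)) \<subseteq> scalings (Fix n)"
    proof (rule right_idealizer_subset[OF t k \<open>3 \<le> N\<close> zero_in_outer_D])
      fix \<alpha> \<beta>
      assume "\<And>d. (\<alpha> * d, \<beta> * d) \<in> outer_D n \<gamma>"
      then show "\<alpha> = 0 \<and> \<beta> = 0"
        using outer_D_sep[OF n \<open>\<gamma> \<noteq> 0\<close>, of \<alpha> \<beta> 0] by simp
    next
      fix \<alpha> \<beta>
      assume *: "\<And>a b. (a, b) \<in> outer_D n \<gamma> \<Longrightarrow> \<alpha> * a + \<beta> * b = 0"
      show "\<alpha> = 0 \<and> \<beta> = 0"
        using *[OF basis_in_outer_D(1)] *[OF basis_in_outer_D(2)] \<open>\<gamma> \<noteq> 0\<close> by simp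
    next
      fix c assume *: "\<And>a b. (a, b) \<in> outer_D n \<gamma> \<Longrightarrow> (a * c, b * \<sigma> (t * k) c) \<in> outer_D n \<gamma>"
      show "c \<in> Fix n"
        using *[OF basis_in_outer_D(1)] by (auto simp: outer_D_def)
    qed
    show "scalings (Fix n) \<subseteq> right_idealizer (code t k (outer_D n \<gamma>))"
      unfolding scalings_def
    proof clarify
      fix c assume "c \<in> Fix n"
      then show "(\<lambda>x. c * x) \<in> right_idealizer (code t k (outer_D n \<gamma>))"
        by (intro scaling_in_right_idealizer) (auto simp: outer_D_def Fix_mult Fix_\<sigma> mult.assoc)
    qed
  qed
qed

lemma zero_in_outer_H: "(0, 0) \<in> outer_H \<eta> h"
  by (simp add: outer_H_def)

text \<open>
  The constraint \<open>b = \<eta> * \<sigma> h a\<close> can hold along a twisted line \<open>(\<alpha> * d, \<beta> * \<sigma> (t * k) d)\<close> only if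
  \<open>\<sigma> h\<close> and \<open>\<sigma> (t * k)\<close> agree, by independence of the automorphisms. In the excluded case the
  other idealizer contains all scalars.
\<close>
lemma left_idealizer_H_subset:
  assumes t: "coprime t N" and k: "0 < k" "k < N" and "3 \<le> N" and "\<eta> \<noteq> 0"
    and h: "h mod N \<noteq> t * k mod N"
  shows "left_idealizer (code t k (outer_H \<eta> h)) \<subseteq> scalings (Fix h)"
proof (rule left_idealizer_subset[OF t k \<open>3 \<le> N\<close> zero_in_outer_H])
  fix \<alpha> \<beta>
  assume W: "\<And>d. (\<alpha> * d, \<beta> * \<sigma> (t * k) d) \<in> outer_H \<eta> h"
  have "\<eta> * \<sigma> h \<alpha> * \<sigma> h d + (- \<beta>) * \<sigma> (t * k) d = 0" for d
    using W[of d] by (auto simp: outer_H_def \<sigma>_mult)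
  from \<sigma>_independent[OF h this] show "\<alpha> = 0 \<and> \<beta> = 0"
    using \<open>\<eta> \<noteq> 0\<close> by simp
next
  fix \<alpha> \<beta> and m :: nat
  assume m: "0 < m" and "k = 1"
    and W: "\<And>a b. (a, b) \<in> outer_H \<eta> h \<Longrightarrow> \<alpha> * \<sigma> (t * m) a + \<beta> * \<sigma> (t * (m - 1)) b = 0"
  have "t * m = t * (m - 1) + t"
    using m by (cases m) auto
  then have neq: "t * m mod N \<noteq> (t * (m - 1) + h) mod N"
    using h \<open>k = 1\<close> cong_add_lcancel_nat[of "t * (m - 1)" t h N] by (auto simp: cong_def)
  have "\<alpha> * \<sigma> (t * m) a + \<beta> * \<sigma> (t * (m - 1)) \<eta> * \<sigma> (t * (m - 1) + h) a = 0" for a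
    using W[of a "\<eta> * \<sigma> h a"] by (simp add: outer_H_def \<sigma>_mult mult.assoc)
  from \<sigma>_independent[OF neq this] show "\<alpha> = 0 \<and> \<beta> = 0"
    using \<open>\<eta> \<noteq> 0\<close> by simp
next
  fix c assume W: "\<And>a b. (a, b) \<in> outer_H \<eta> h \<Longrightarrow> (c * a, c * b) \<in> outer_H \<eta> h"
  show "c \<in> Fix h"
    using W[of 1 \<eta>] \<open>\<eta> \<noteq> 0\<close> by (auto simp: outer_H_def Fix_def)
qed

text \<open>
  For the right idealizer the excluded exponent is \<open>h = 0\<close>. A scalar \<open>c\<close> preserves the constraint when
  \<open>\<sigma> (t * k) c = \<sigma> h c\<close>; the exponent \<open>N - h + t * k\<close> is \<open>t * k - h\<close> modulo \<open>N\<close>.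
\<close>
lemma right_idealizer_H_subset:
  assumes t: "coprime t N" and k: "0 < k" "k < N" and "3 \<le> N" and "\<eta> \<noteq> 0"
    and h: "h mod N \<noteq> 0" "h < N"
  shows "right_idealizer (code t k (outer_H \<eta> h)) \<subseteq> scalings (Fix (N - h + t * k))"
proof (rule right_idealizer_subset[OF t k \<open>3 \<le> N\<close> zero_in_outer_H])
  fix \<alpha> \<beta>
  assume W: "\<And>d. (\<alpha> * d, \<beta> * d) \<in> outer_H \<eta> h"
  have eq: "\<eta> * \<sigma> h \<alpha> * \<sigma> h d + (- \<beta>) * \<sigma> 0 d = 0" for d
    using W[of d] by (auto simp: outer_H_def \<sigma>_mult)
  have "h mod N \<noteq> 0 mod N" using h by simp
  from \<sigma>_independent[OF this eq] show "\<alpha> = 0 \<and> \<beta> = 0"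
    using \<open>\<eta> \<noteq> 0\<close> by simp
next
  fix \<alpha> \<beta>
  assume W: "\<And>a b. (a, b) \<in> outer_H \<eta> h \<Longrightarrow> \<alpha> * a + \<beta> * b = 0"
  have eq: "\<beta> * \<eta> * \<sigma> h a + \<alpha> * \<sigma> 0 a = 0" for a
    using W[of a "\<eta> * \<sigma> h a"] by (simp add: outer_H_def mult.assoc add.commute)
  have "h mod N \<noteq> 0 mod N" using h by simp
  from \<sigma>_independent[OF this eq] show "\<alpha> = 0 \<and> \<beta> = 0"
    using \<open>\<eta> \<noteq> 0\<close> by simp
next
  fix c assume W: "\<And>a b. (a, b) \<in> outer_H \<eta> h \<Longrightarrow> (a * c, b * \<sigma> (t * k) c) \<in> outer_H \<eta> h"
  have "\<sigma> (t * k) c = \<sigma> h c"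
    using W[of 1 \<eta>] \<open>\<eta> \<noteq> 0\<close> by (auto simp: outer_H_def)
  then have "\<sigma> (N - h) (\<sigma> (t * k) c) = \<sigma> (N - h) (\<sigma> h c)"
    by (rule arg_cong)
  then show "c \<in> Fix (N - h + t * k)"
    using \<open>h < N\<close> by (simp add: Fix_def)
qed

lemma left_idealizer_H_superset: "scalings (Fix h) \<subseteq> left_idealizer (code t k (outer_H \<eta> h))"
  unfolding scalings_def
proof clarify
  fix c assume "c \<in> Fix h"
  then show "(\<lambda>x. c * x) \<in> left_idealizer (code t k (outer_H \<eta> h))"
    by (intro scaling_in_left_idealizer) (auto simp: outer_H_def Fix_def \<sigma>_mult mult.left_commute)
qed

lemma right_idealizer_H_superset:
  assumes "h mod N = t * k mod N"
  shows "scalings UNIV \<subseteq> right_idealizer (code t k (outer_H \<eta> h))"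
  unfolding scalings_def
proof clarify
  fix c
  have "\<sigma> h c = \<sigma> (t * k) c"
    using assms by (rule \<sigma>_cong)
  then show "(\<lambda>x. c * x) \<in> right_idealizer (code t k (outer_H \<eta> h))"
    by (intro scaling_in_right_idealizer) (auto simp: outer_H_def \<sigma>_mult mult.assoc)
qed

text \<open>
  If \<open>h = 0\<close>, or \<open>h = t * k\<close> modulo \<open>N\<close>, then one idealizer of the twisted Gabidulin code contains
  all \<open>q ^ N\<close> scalars, too many for \<open>idealizers_D\<close>. Otherwise its idealizers lie in the fixed fields of
  \<open>\<sigma> h\<close> and \<open>\<sigma> (t * k - h)\<close> and must both have room for \<open>q ^ n\<close> scalars. This forces both exponents to
  be \<open>n\<close> modulo \<open>2 * n\<close>, so that \<open>N\<close> divides \<open>t * k\<close>, against \<open>0 < k < N\<close>.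
\<close>
lemma codes_not_equivalent:
  assumes N: "N = 2 * n" and "2 \<le> n" and s: "coprime s N" and t: "coprime t N"
    and k: "0 < k" "k < N" and "\<gamma> \<noteq> 0" "\<eta> \<noteq> 0" and h: "h < N"
    and \<phi>1: "\<phi>1 \<in> linear_maps" "bij \<phi>1" and \<phi>2: "\<phi>2 \<in> linear_maps" "bij \<phi>2"
  shows "code t k (outer_H \<eta> h) \<noteq> (\<lambda>g. \<phi>1 \<circ> g \<circ> \<phi>2) ` code s k (outer_D n \<gamma>)"
proof
  let ?H = "code t k (outer_H \<eta> h)" and ?D = "code s k (outer_D n \<gamma>)"
  assume eq: "?H = (\<lambda>g. \<phi>1 \<circ> g \<circ> \<phi>2) ` ?D"
  have n: "0 < n" "n < N" "3 \<le> N"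
    using N \<open>2 \<le> n\<close> by auto
  note eq' = equivalence_inverse[OF \<phi>1(2) \<phi>2(2) eq]
  note inv1 = linear_maps_inverse[OF \<phi>1] bij_imp_bij_inv[OF \<phi>1(2)]
  note inv2 = linear_maps_inverse[OF \<phi>2] bij_imp_bij_inv[OF \<phi>2(2)]
  note D = idealizers_D[OF s k n(3,1,2) \<open>\<gamma> \<noteq> 0\<close>]
  have "card (Fix n) \<le> q ^ n"
    by (rule card_Fix_le[OF n(1)])
  also have "\<dots> < card (UNIV :: 'a set)"
    unfolding card_L using q_gt_1 n(2) by (rule power_strict_increasing[rotated])
  finally have small: "card (Fix n) < card (UNIV :: 'a set)" .
  have h0: "h mod N \<noteq> 0"
  proof
    assume "h mod N = 0"
    then have "Fix h = UNIV"
      using h by (simp add: Fix_def)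
    then have "card (UNIV :: 'a set) \<le> card (Fix n)"
      using card_le_by_left_idealizers[OF inv1 eq' left_idealizer_H_superset equalityD1[OF D(1)]] by simp
    then show False using small by simp
  qed
  have htk: "h mod N \<noteq> t * k mod N"
  proof
    assume "h mod N = t * k mod N"
    then have "card (UNIV :: 'a set) \<le> card (Fix n)"
      by (rule card_le_by_right_idealizers[OF inv2 eq' right_idealizer_H_superset equalityD1[OF D(2)]])
    then show False using small by simp
  qed
  have "q ^ n \<le> card (Fix h)"
    using card_Fix_ge[OF N]
      card_le_by_left_idealizers[OF \<phi>1 eq equalityD2[OF D(1)] left_idealizer_H_subset[OF t k n(3) \<open>\<eta> \<noteq> 0\<close> htk]]
    by (rule order_trans)
  then have "n dvd h"
    using h0 by (intro dvd_if_large_Fix[OF N]) (auto simp: dvd_eq_mod_eq_0)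
  then have h_n: "h = n"
    using h h0 N by (auto elim!: dvdE)
  have "q ^ n \<le> card (Fix (N - h + t * k))"
    using card_Fix_ge[OF N]
      card_le_by_right_idealizers[OF \<phi>2 eq equalityD2[OF D(2)] right_idealizer_H_subset[OF t k n(3) \<open>\<eta> \<noteq> 0\<close> h0 h]]
    by (rule order_trans)
  moreover have "\<not> N dvd N - h + t * k"
  proof
    assume "N dvd N - h + t * k"
    then obtain c where "N - h + t * k = N * c" ..
    then have "t * k + N = h + N * c"
      using h by linarith
    then have "(t * k + N) mod N = (h + N * c) mod N"
      by (rule arg_cong)
    then show False
      using htk by simp
  qed
  ultimately have "n dvd N - h + t * k"
    by (intro dvd_if_large_Fix[OF N])
  then have "n dvd t * k"
    using h_n N by (simp add: dvd_add_right_iff)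
  then obtain m where m: "t * k = n * m" ..
  have "even m"
  proof (rule ccontr)
    assume "odd m"
    then obtain l where "m = 2 * l + 1" by (elim oddE)
    then have "t * k = n + N * l"
      using m N by (simp add: algebra_simps)
    then show False
      using htk h_n by simp
  qed
  then have "N dvd t * k"
    using m N by auto
  then have "N dvd k"
    using t by (simp add: coprime_commute coprime_dvd_mult_right_iff)
  then show False
    using k nat_dvd_not_less by blast
qed

end

section \<open>From reduced polynomials to maps\<close>

lemma map_poly_add_hom:
  assumes "\<And>x y. f (x + y) = f x + f y" "f 0 = 0"
  shows "map_poly f (p + q) = map_poly f p + map_poly f q"
  by (rule poly_eqI) (simp add: coeff_map_poly assms)

lemma map_poly_sum_hom:
  assumes "\<And>x y. f (x + y) = f x + f y" "f 0 = 0"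
  shows "map_poly f (\<Sum>i\<in>A. p i) = (\<Sum>i\<in>A. map_poly f (p i))"
  by (induction A rule: infinite_finite_induct) (auto simp: map_poly_add_hom assms)

context finite_extension
begin

lemma code_diff:
  assumes W: "\<And>a b c d. (a, b) \<in> W \<Longrightarrow> (c, d) \<in> W \<Longrightarrow> (a - c, b - d) \<in> W"
    and "f \<in> code t k W" "g \<in> code t k W"
  shows "(\<lambda>x. f x - g x) \<in> code t k W"
proof -
  obtain a where a: "f = lin t a" "(a 0, a k) \<in> W" "\<forall>m. k < m \<and> m < N \<longrightarrow> a m = 0"
    using assms(2) by (auto simp: code_def)
  obtain b where b: "g = lin t b" "(b 0, b k) \<in> W" "\<forall>m. k < m \<and> m < N \<longrightarrow> b m = 0"
    using assms(3) by (auto simp: code_def)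
  have "(\<lambda>x. f x - g x) = lin t (\<lambda>i. a i - b i)"
    by (auto simp: a(1) b(1) lin_def sum_subtractf algebra_simps)
  then show ?thesis
    unfolding code_def using a b W by (intro CollectI exI[of _ "\<lambda>i. a i - b i"]) auto
qed

lemma zero_in_code: "(0, 0) \<in> W \<Longrightarrow> (\<lambda>_. 0) \<in> code t k W"
  unfolding code_def by (intro CollectI exI[of _ "\<lambda>_. 0"]) (auto simp: lin_def)

lemma lin_truncate:
  assumes "k < N" "\<And>m. k < m \<Longrightarrow> m < N \<Longrightarrow> h m = 0"
  shows "lin t h x = (\<Sum>i<k. h i * \<sigma> (t * i) x) + h k * \<sigma> (t * k) x"
proof -
  have "lin t h x = (\<Sum>i<Suc k. h i * \<sigma> (t * i) x)"
    unfolding lin_def by (rule sum.mono_neutral_right) (use assms in auto)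
  then show ?thesis by simp
qed

lemma \<sigma>_diff: "\<sigma> m (x - y) = \<sigma> m x - \<sigma> m y"
  using \<sigma>_add[of m "x - y" y] by (simp add: eq_diff_eq)

text \<open>
  Both codes are additive groups, so \<open>\<psi>\<close>, being the image of 0, lies in \<open>C2\<close> and translation by it
  leaves \<open>C2\<close> unchanged.
\<close>
lemma translation_absorbed:
  assumes "\<phi>1 \<in> linear_maps"
    and C2: "C2 = (\<lambda>g x. \<phi>1 (g (\<phi>2 x)) + \<psi> x) ` C1"
    and zero: "(\<lambda>_. 0) \<in> C1" "(\<lambda>_. 0) \<in> C2"
    and diff: "\<And>f g. f \<in> C2 \<Longrightarrow> g \<in> C2 \<Longrightarrow> (\<lambda>x. f x - g x) \<in> C2"
  shows "C2 = (\<lambda>g. \<phi>1 \<circ> g \<circ> \<phi>2) ` C1"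
proof -
  have \<psi>: "\<psi> \<in> C2"
    unfolding C2 using zero(1) linear_maps_zero[OF assms(1)] by (intro image_eqI[of _ _ "\<lambda>_. 0"]) auto
  show ?thesis
  proof (intro equalityI subsetI)
    fix f assume "f \<in> C2"
    \<comment> \<open>Closure under differences alone is assumed, hence the sum \<open>f + \<psi>\<close> in this form.\<close>
    then have "(\<lambda>x. f x - (0 - \<psi> x)) \<in> C2"
      using diff[OF _ diff[OF zero(2) \<psi>]] by blast
    then obtain g where g: "g \<in> C1" "(\<lambda>x. f x - (0 - \<psi> x)) = (\<lambda>x. \<phi>1 (g (\<phi>2 x)) + \<psi> x)"
      using C2 by blast
    have "f x = \<phi>1 (g (\<phi>2 x))" for x
      using fun_cong[OF g(2), of x] by simp
    then show "f \<in> (\<lambda>g. \<phi>1 \<circ> g \<circ> \<phi>2) ` C1"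
      using g(1) by (intro image_eqI[of _ _ g]) auto
  next
    fix f assume "f \<in> (\<lambda>g. \<phi>1 \<circ> g \<circ> \<phi>2) ` C1"
    then obtain g where g: "g \<in> C1" "f = \<phi>1 \<circ> g \<circ> \<phi>2"
      by blast
    then have "(\<lambda>x. \<phi>1 (g (\<phi>2 x)) + \<psi> x) \<in> C2"
      using C2 by blast
    from diff[OF this \<psi>] show "f \<in> C2"
      by (simp add: g(2) comp_def)
  qed
qed

lemma poly_qX:
  assumes "N = 2 * n"
  shows "poly (qX q n (int i)) x = \<sigma> i x"
proof -
  have "nat (int i mod int (2 * n)) = i mod N"
    by (simp only: assms nat_int flip: zmod_int)
  then have "poly (qX q n (int i)) x = \<sigma> (i mod N) x"
    by (simp add: qX_def poly_monom \<sigma>_def)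
  then show ?thesis by simp
qed

lemma poly_qpolys:
  assumes "N = 2 * n" "f \<in> qpolys q n"
  shows "poly f \<in> linear_maps"
proof -
  obtain c where "f = (\<Sum>i<2 * n. smult (c i) (qX q n (int i)))"
    using assms(2) by (auto simp: qpolys_def)
  then have "poly f = lin 1 c"
    by (simp add: fun_eq_iff poly_sum poly_qX[OF assms(1)] lin_def flip: assms(1))
  then show ?thesis
    by (simp add: linear_maps_def)
qed

text \<open>
  The modulus \<open>X ^ (q ^ N) - X\<close> vanishes on the whole field, so reduction is invisible to evaluation.
\<close>
lemma poly_qcomp:
  fixes f g :: "'a poly"
  assumes "N = 2 * n"
  shows "poly (qcomp q n f g) x = poly f (poly g x)"
proof -
  let ?m = "monom 1 (q ^ (2 * n)) - monom 1 1 :: 'a poly"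
  have "poly ?m x = 0"
    using \<sigma>_N[of x] assms by (simp add: poly_monom \<sigma>_def)
  moreover have "poly (pcompose f g) x
      = poly (pcompose f g div ?m) x * poly ?m x + poly (pcompose f g mod ?m) x"
    unfolding poly_mult[symmetric] poly_add[symmetric] div_mult_mod_eq ..
  ultimately show ?thesis
    by (simp add: qcomp_def poly_pcompose)
qed

lemma Fix_eq_Fq_sub: "Fix m = Fq_sub q m"
  by (simp add: Fix_def Fq_sub_def \<sigma>_def)

lemma poly_H_code:
  assumes N: "N = 2 * n" and k: "0 < k" "k < N"
  shows "poly ` H_code q n k t \<eta> h = code t k (outer_H \<eta> (nat (h mod int N)))"
proof -
  let ?h = "nat (h mod int N)"
  define P where "P a = (\<Sum>i<k. smult (a i) (qX q n (int (t * i))))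
        + smult (\<eta> * a 0 ^ (q ^ ?h)) (qX q n (int (t * k)))" for a
  have H: "H_code q n k t \<eta> h = range P"
    unfolding H_code_def P_def N by auto
  have poly_P: "poly (P a) x = (\<Sum>i<k. a i * \<sigma> (t * i) x) + \<eta> * \<sigma> ?h (a 0) * \<sigma> (t * k) x" for a x
    by (simp add: P_def poly_sum poly_qX[OF N] del: of_nat_mult) (simp add: \<sigma>_def)
  show ?thesis
    unfolding H
  proof (intro equalityI subsetI)
    fix f assume "f \<in> poly ` range P"
    then obtain a where f: "f = poly (P a)" by blast
    define b where "b m = (if m < k then a m else if m = k then \<eta> * \<sigma> ?h (a 0) else 0)" for m
    have "lin t b x = f x" for x
      using lin_truncate[OF k(2), of b t x] by (simp add: f poly_P b_def)
    then have "f = lin t b" by auto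
    then show "f \<in> code t k (outer_H \<eta> ?h)"
      unfolding code_def by (intro CollectI exI[of _ b]) (use k in \<open>auto simp: b_def outer_H_def\<close>)
  next
    fix f assume "f \<in> code t k (outer_H \<eta> ?h)"
    then obtain a where a: "f = lin t a" "(a 0, a k) \<in> outer_H \<eta> ?h" "\<forall>m. k < m \<and> m < N \<longrightarrow> a m = 0"
      by (auto simp: code_def)
    then have "f x = poly (P a) x" for x
      using lin_truncate[OF k(2), of a t x] by (auto simp: poly_P outer_H_def)
    then show "f \<in> poly ` range P"
      by (auto simp: fun_eq_iff)
  qed
qed

lemma poly_D_code:
  assumes N: "N = 2 * n" and k: "0 < k" "k < N"
  shows "poly ` D_code q n k s \<gamma> = code s k (outer_D n \<gamma>)"
proof -
  define P where "P a b c = smult a (qX q n 0) + (\<Sum>i=1..k - 1. smult (c i) (qX q n (int (i * s))))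
        + smult (\<gamma> * b) (qX q n (int (k * s)))" for a b :: 'a and c :: "nat \<Rightarrow> 'a"
  have poly_P: "poly (P a b c) x
      = (\<Sum>i<k. (if i = 0 then a else c i) * \<sigma> (s * i) x) + \<gamma> * b * \<sigma> (s * k) x" for a b c x
  proof -
    have "{..<k} = insert 0 {1..k - 1}"
      using k by auto
    moreover have "poly (qX q n 0) x = x"
      using poly_qX[OF N, of 0 x] by simp
    ultimately show ?thesis
      by (simp add: P_def poly_sum poly_qX[OF N] mult.commute del: of_nat_mult)
  qed
  show ?thesis
  proof (intro equalityI subsetI)
    fix f assume "f \<in> poly ` D_code q n k s \<gamma>"
    then obtain a b c where f: "f = poly (P a b c)" and ab: "a \<in> Fix n" "b \<in> Fix n"
      by (auto simp: D_code_def P_def Fix_eq_Fq_sub)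
    define d where "d m = (if m = 0 then a else if m < k then c m else if m = k then \<gamma> * b else 0)" for m
    have "lin s d x = f x" for x
      using lin_truncate[OF k(2), of d s x] k by (simp add: f poly_P d_def) (auto intro!: sum.cong)
    then have "f = lin s d" by auto
    then show "f \<in> code s k (outer_D n \<gamma>)"
      unfolding code_def by (intro CollectI exI[of _ d]) (use k ab in \<open>auto simp: d_def outer_D_def\<close>)
  next
    fix f assume "f \<in> code s k (outer_D n \<gamma>)"
    then obtain d where d: "f = lin s d" "(d 0, d k) \<in> outer_D n \<gamma>" "\<forall>m. k < m \<and> m < N \<longrightarrow> d m = 0"
      by (auto simp: code_def)
    then obtain b where b: "d 0 \<in> Fix n" "b \<in> Fix n" "d k = \<gamma> * b"
      by (auto simp: outer_D_def)
    have "f x = poly (P (d 0) b d) x" for x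
      using lin_truncate[OF k(2), of d s x] d by (auto simp: poly_P b(3) intro!: sum.cong)
    then have "f = poly (P (d 0) b d)" by auto
    moreover have "P (d 0) b d \<in> D_code q n k s \<gamma>"
      unfolding D_code_def P_def using b by (auto simp: Fix_eq_Fq_sub)
    ultimately show "f \<in> poly ` D_code q n k s \<gamma>"
      by blast
  qed
qed

text \<open>
  A field automorphism permutes the coefficients and preserves the subfield, hence changes only
  the parameter \<open>\<gamma>\<close> of the code.
\<close>
lemma D_code_frobenius:
  fixes e :: nat
  defines "\<rho> \<equiv> (\<lambda>x :: 'a. x ^ (CHAR('a) ^ e))"
  shows "map_poly \<rho> ` D_code q n k s \<gamma> = D_code q n k s (\<rho> \<gamma>)"
proof -
  have add: "\<rho> (x + y) = \<rho> x + \<rho> y" for x y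
    unfolding \<rho>_def by (rule freshmans_dream'[OF prime_CHAR refl])
  have zero_iff: "\<rho> x = 0 \<longleftrightarrow> x = 0" for x
    using prime_gt_0_nat[OF prime_CHAR] by (simp add: \<rho>_def)
  have mult: "\<rho> (x * y) = \<rho> x * \<rho> y" and \<rho>1: "\<rho> 1 = 1" for x y
    by (simp_all add: \<rho>_def power_mult_distrib)
  have "inj \<rho>"
  proof (rule injI)
    fix x y assume "\<rho> x = \<rho> y"
    then have "\<rho> (x - y) = 0"
      using add[of "x - y" y] by simp
    then show "x = y"
      by (simp add: zero_iff)
  qed
  then have "surj \<rho>"
    by (simp add: finite_UNIV_inj_surj)
  have Fix: "\<rho> x \<in> Fq_sub q n \<longleftrightarrow> x \<in> Fq_sub q n" for x
  proof -
    have "\<rho> x ^ (q ^ n) = \<rho> (x ^ (q ^ n))"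
      by (simp add: \<rho>_def mult.commute flip: power_mult)
    then show ?thesis
      using \<open>inj \<rho>\<close> by (simp add: Fq_sub_def inj_eq)
  qed
  have qX: "map_poly \<rho> (qX q n i) = qX q n i" for i
    by (simp add: qX_def map_poly_monom zero_iff \<rho>1)
  have image: "map_poly \<rho> (smult a (qX q n 0) + (\<Sum>i=1..k - 1. smult (c i) (qX q n (int (i * s))))
        + smult (\<gamma> * b) (qX q n (int (k * s))))
      = smult (\<rho> a) (qX q n 0) + (\<Sum>i=1..k - 1. smult (\<rho> (c i)) (qX q n (int (i * s))))
        + smult (\<rho> \<gamma> * \<rho> b) (qX q n (int (k * s)))" for a b c
    by (simp only: map_poly_add_hom[of \<rho>] map_poly_sum_hom[of \<rho>] map_poly_smult[of \<rho>] add mult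
        zero_iff refl qX)
  show ?thesis
  proof (intro equalityI subsetI)
    fix f assume "f \<in> map_poly \<rho> ` D_code q n k s \<gamma>"
    then obtain a b c where "a \<in> Fq_sub q n" "b \<in> Fq_sub q n"
      "f = map_poly \<rho> (smult a (qX q n 0) + (\<Sum>i=1..k - 1. smult (c i) (qX q n (int (i * s))))
        + smult (\<gamma> * b) (qX q n (int (k * s))))"
      unfolding D_code_def by blast
    then show "f \<in> D_code q n k s (\<rho> \<gamma>)"
      unfolding D_code_def image
      by (intro CollectI exI[of _ "\<rho> a"] exI[of _ "\<rho> b"] exI[of _ "\<lambda>i. \<rho> (c i)"]) (auto simp: Fix)
  next
    fix f assume "f \<in> D_code q n k s (\<rho> \<gamma>)"
    then obtain a b c where ab: "a \<in> Fq_sub q n" "b \<in> Fq_sub q n"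
      and f: "f = smult a (qX q n 0) + (\<Sum>i=1..k - 1. smult (c i) (qX q n (int (i * s))))
        + smult (\<rho> \<gamma> * b) (qX q n (int (k * s)))"
      unfolding D_code_def by blast
    define a' b' c' where "a' = inv \<rho> a" "b' = inv \<rho> b" "c' i = inv \<rho> (c i)" for i
    have inv: "\<rho> a' = a" "\<rho> b' = b" "\<And>i. \<rho> (c' i) = c i"
      using surj_f_inv_f[OF \<open>surj \<rho>\<close>] by (auto simp: a'_b'_c'_def)
    show "f \<in> map_poly \<rho> ` D_code q n k s \<gamma>"
    proof (rule image_eqI)
      show "f = map_poly \<rho> (smult a' (qX q n 0) + (\<Sum>i=1..k - 1. smult (c' i) (qX q n (int (i * s))))
        + smult (\<gamma> * b') (qX q n (int (k * s))))"
        unfolding image inv f ..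
      show "smult a' (qX q n 0) + (\<Sum>i=1..k - 1. smult (c' i) (qX q n (int (i * s))))
        + smult (\<gamma> * b') (qX q n (int (k * s))) \<in> D_code q n k s \<gamma>"
        using ab Fix[of a'] Fix[of b'] unfolding D_code_def inv by blast
    qed
  qed
qed

end

theorem theorem13:
  fixes q n s t k :: nat and h :: int and \<gamma> \<eta> :: "'a::{field, finite}"
  assumes "primepow q" and "card (UNIV :: 'a set) = q ^ (2 * n)"
    and "n \<ge> 2" and "s > 0" and "t > 0"
    and "gcd (2 * n) s = 1" and "gcd (2 * n) t = 1"
    and "\<gamma> \<noteq> 0" and "\<eta> \<noteq> 0"
    and "\<not> (\<exists>y\<in>Fq_sub q 1. field_norm q n \<gamma> = y ^ 2)"
    and "field_norm q n \<eta> \<noteq> 1"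
    and "1 \<le> k" and "k \<le> 2 * n - 1"
  shows "\<not> code_equivalent q n (D_code q n k s \<gamma>) (H_code q n k t \<eta> h)"
proof
  interpret finite_extension q "2 * n" "TYPE('a)"
    by standard (use assms in auto)
  have k: "0 < k" "k < 2 * n"
    using assms by auto
  define h' where "h' = nat (h mod int (2 * n))"
  have "h' < 2 * n"
    using \<open>n \<ge> 2\<close> by (simp add: h'_def nat_less_iff)
  assume "code_equivalent q n (D_code q n k s \<gamma>) (H_code q n k t \<eta> h)"
  then obtain \<phi>1 \<phi>2 \<psi> e where \<phi>: "\<phi>1 \<in> qpolys q n" "\<phi>2 \<in> qpolys q n" "bij (poly \<phi>1)" "bij (poly \<phi>2)"
    and H: "H_code q n k t \<eta> h = {qcomp q n \<phi>1 (qcomp q n (map_poly (\<lambda>x. x ^ (CHAR('a) ^ e)) f) \<phi>2) + \<psi>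
      | f. f \<in> D_code q n k s \<gamma>}"
    unfolding code_equivalent_def by blast
  define \<gamma>' where "\<gamma>' = \<gamma> ^ (CHAR('a) ^ e)"
  let ?C1 = "code s k (outer_D n \<gamma>')" and ?C2 = "code t k (outer_H \<eta> h')"
  have "H_code q n k t \<eta> h = (\<lambda>f. qcomp q n \<phi>1 (qcomp q n f \<phi>2) + \<psi>) ` D_code q n k s \<gamma>'"
    unfolding H \<gamma>'_def D_code_frobenius[symmetric] by blast
  moreover have "poly (qcomp q n \<phi>1 (qcomp q n f \<phi>2) + \<psi>)
      = (\<lambda>x. poly \<phi>1 (poly f (poly \<phi>2 x)) + poly \<psi> x)" for f
    by (simp add: fun_eq_iff poly_qcomp[OF refl])
  ultimately have "poly ` H_code q n k t \<eta> h
      = (\<lambda>g x. poly \<phi>1 (g (poly \<phi>2 x)) + poly \<psi> x) ` poly ` D_code q n k s \<gamma>'"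
    by (simp only: image_image)
  then have "?C2 = (\<lambda>g x. poly \<phi>1 (g (poly \<phi>2 x)) + poly \<psi> x) ` ?C1"
    by (simp only: poly_H_code[OF refl k] poly_D_code[OF refl k] h'_def)
  then have equiv: "?C2 = (\<lambda>g. poly \<phi>1 \<circ> g \<circ> poly \<phi>2) ` ?C1"
  proof (rule translation_absorbed[OF poly_qpolys[OF refl \<phi>(1)]])
    show "(\<lambda>_. 0) \<in> ?C1" "(\<lambda>_. 0) \<in> ?C2"
      by (intro zero_in_code zero_in_outer_D zero_in_outer_H)+
    show "(\<lambda>x. f x - g x) \<in> ?C2" if "f \<in> ?C2" "g \<in> ?C2" for f g
      using that by (intro code_diff) (auto simp: outer_H_def \<sigma>_diff right_diff_distrib)
  qed
  have st: "coprime s (2 * n)" "coprime t (2 * n)"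
    using assms(6,7) by (simp_all only: coprime_iff_gcd_eq_1 gcd.commute)
  have "\<gamma>' \<noteq> 0"
    using \<open>\<gamma> \<noteq> 0\<close> by (simp add: \<gamma>'_def)
  show False
    using codes_not_equivalent[OF refl \<open>n \<ge> 2\<close> st k \<open>\<gamma>' \<noteq> 0\<close> \<open>\<eta> \<noteq> 0\<close> \<open>h' < 2 * n\<close>
        poly_qpolys[OF refl \<phi>(1)] \<phi>(3) poly_qpolys[OF refl \<phi>(2)] \<phi>(4)] equiv
    by (rule notE)
qed

end
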